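(* Let $\alpha\in(0,1)$, $\sigma=1-\alpha/2$, let $\Omega\subset\mathbb R^d$ be a bounded Lipschitz domain, and let $\varepsilon>0$, $\Delta t>0$, $T_{\rm soe}>\Delta t$ together with a fixed sum-of-exponentials (SOE) approximation be as in the context. Assume $f\in L^\infty([0,\infty);L^2(\Omega))\cap BV([0,\infty);L^2(\Omega))$ and $u^0\in H_0^1(\Omega)$. Let $\{\tau_k\}_{k\ge1}$ be an arbitrary nonuniform mesh satisfying $$\rho_k\ge \eta\ \ (k\ge 2),\qquad \varepsilon\le \min_{k\ge1}\frac{1}{5(1-\alpha)(\sigma\tau_k)^\alpha},\qquad \Delta t\le \min_{k\ge2}\sigma\tau_k,\qquad T_{\rm soe}\ge\max_{k\ge2}(\sigma\tau_{k+1}+\tau_k),$$ where $\rho_k=\tau_k/\tau_{k-1}$ and $\eta\approx0.475329$ is the unique positive root of $1-3\rho^2(1+\rho)=0$. Then the numerical solution $(u^k)_{k\ge1}$ of the fast L2-1$_\sigma$ scheme $$F_k^{\alpha,*}u=(1-\alpha/2)\Delta u^k+(\alpha/2)\Delta u^{k-1}+f(t_k^*,\cdot)\ \text{ in }\Omega,\qquad u^k=0\ \text{ on }\partial\Omega,\qquad k\ge1,$$ for the linear subdiffusion equation $\partial_t^\alpha u=\Delta u+f$ with homogeneous Dirichlet boundary condition and initial value $u^0$ satisfies $$\|\nabla u^n\|\le\|\nabla u^0\|+2C_fC_\Omega,\qquad\forall n\ge1,$$ where $C_f=2\|f\|_{L^\infty([0,\infty);L^2(\Omega))}+\|f\|_{BV([0,\infty);L^2(\Omega))}$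 and $C_\Omega$ is the Sobolev embedding constant depending on $\Omega$ and the dimension $d$, i.e. $\|v\|\le C_\Omega\|\nabla v\|$ for all $v\in H_0^1(\Omega)$.
   Context: $\langle\cdot,\cdot\rangle$ and $\|\cdot\|$ are the $L^2(\Omega)$ inner product and norm. The function $f:[0,\infty)\to L^2(\Omega)$ is evaluated pointwise in time; $\|f\|_{L^\infty([0,\infty);L^2(\Omega))}=\sup_{t\ge0}\|f(t)\|$ and $\|f\|_{BV([0,\infty);L^2(\Omega))}$ is the total variation of $f$ in time with values in $L^2(\Omega)$, i.e. $\sup\sum_i\|f(s_{i})-f(s_{i-1})\|$ over finite sequences $0\le s_0<s_1<\cdots$. Mesh: $0=t_0<t_1<t_2<\cdots$, $\tau_k=t_k-t_{k-1}$ ($k\ge1$), $t_k^*=t_{k-1}+\sigma\tau_k$. For a sequence $u^0,u^1,\dots$, $\delta_ku=u^k-u^{k-1}$. A minimum (resp. maximum) over infinitely many $k$ in a condition means that the inequality holds for every such $k$. SOE approximation: $N_q\ge 1$ is an integer and $\theta^\ell>0$, $\varpi^\ell>0$ ($1\le\ell\le N_q$) are fixed numbers such that $\big|t^{-\alpha}-\sum_{\ell=1}^{N_q}\varpi^\ell e^{-\theta^\ell t}\big|\le\varepsilon$ for all $t\in[\Delta t,T_{\rm soe}]$ (it is a known result that such numbers exist). $T_{\rm soe}$ is not required to bound the times $t_k$. Coefficients: for $1\le j\le k-1$, $$\hat a_j^{(k)}=\int_{t_{j-1}}^{t_j}\frac{2s-t_j-t_{j+1}}{\tau_j(\tau_j+\tau_{j+1})}\sum_{\ell=1}^{N_q}\varpi^\ell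 e^{-\theta^\ell(t_k^*-s)}\,ds,\qquad \hat c_j^{(k)}=\int_{t_{j-1}}^{t_j}\frac{2s-t_{j-1}-t_j}{\tau_{j+1}(\tau_j+\tau_{j+1})}\sum_{\ell=1}^{N_q}\varpi^\ell e^{-\theta^\ell(t_k^*-s)}\,ds,$$ $\hat c_0^{(k)}=0$, and $\hat d_j^{(k)}=\hat c_{j-1}^{(k)}-\hat a_j^{(k)}$. Fast L2-1$_\sigma$ operator ($k\ge1$): $$F_k^{\alpha,*}u=\frac1{\Gamma(1-\alpha)}\Big(\hat c_{k-1}^{(k)}\delta_ku+\sum_{j=1}^{k-1}\hat d_j^{(k)}\delta_ju\Big)+\frac{\sigma^{1-\alpha}}{\Gamma(2-\alpha)\tau_k^\alpha}\delta_ku.$$ The scheme is understood in the weak sense: $u^k\in H_0^1(\Omega)$ and $\langle F_k^{\alpha,*}u,v\rangle=-\langle(1-\alpha/2)\nabla u^k+(\alpha/2)\nabla u^{k-1},\nabla v\rangle+\langle f(t_k^* ),v\rangle$ for all $v\in H_0^1(\Omega)$, $k\ge1$. *)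

theory Defs
  imports "HOL-Analysis.Analysis"
begin

section \<open>The space \<open>L\<^sup>2\<close> and its inner product\<close>

text \<open>Elements of \<open>L\<^sup>2(\<Omega>)\<close> are represented by functions on the ambient space rather than by
  equivalence classes; values outside \<open>\<Omega>\<close> are irrelevant, and the norm of a function vanishes
  iff the function vanishes almost everywhere on \<open>\<Omega>\<close>. The codomain is \<open>real\<close> for scalar
  functions and the ambient space itself for gradients.\<close>

definition L2 :: "'a::euclidean_space set \<Rightarrow> ('a \<Rightarrow> 'b::euclidean_space) set" where
  "L2 \<Omega> = {v. v \<in> borel_measurable (lebesgue_on \<Omega>) \<and>
               integrable (lebesgue_on \<Omega>) (\<lambda>x. (norm (v x))\<^sup>2)}"

definition L2_inner ::
  "'a::euclidean_space set \<Rightarrow> ('a \<Rightarrow> 'b::euclidean_space) \<Rightarrow> ('a \<Rightarrow> 'b) \<Rightarrow> real" where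
  "L2_inner \<Omega> v w = (LINT x|lebesgue_on \<Omega>. v x \<bullet> w x)"

definition L2_norm :: "'a::euclidean_space set \<Rightarrow> ('a \<Rightarrow> 'b::euclidean_space) \<Rightarrow> real" where
  "L2_norm \<Omega> v = sqrt (L2_inner \<Omega> v v)"


section \<open>Bounded Lipschitz domains\<close>

text \<open>Near each boundary point, \<open>\<Omega>\<close> lies on one side of the graph of a Lipschitz function. The unit
  vector \<open>e\<close> is the vertical direction of the local coordinate system, and \<open>y - (y \<bullet> e) *\<^sub>R e\<close> is the
  horizontal component of \<open>y\<close>.\<close>

definition bounded_lipschitz_domain :: "'a::euclidean_space set \<Rightarrow> bool" where
  "bounded_lipschitz_domain \<Omega> \<longleftrightarrow>
     \<Omega> \<noteq> {} \<and> open \<Omega> \<and> connected \<Omega> \<and> bounded \<Omega> \<and>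
     (\<forall>x\<in>frontier \<Omega>. \<exists>r>0. \<exists>e L \<gamma>. norm e = 1 \<and> L-lipschitz_on {z. z \<bullet> e = 0} \<gamma> \<and>
        \<Omega> \<inter> ball x r = {y \<in> ball x r. \<gamma> (y - (y \<bullet> e) *\<^sub>R e) < y \<bullet> e})"


section \<open>Weak gradients and the space \<open>H\<^sub>0\<^sup>1\<close>\<close>

primrec Ck :: "nat \<Rightarrow> ('a::euclidean_space \<Rightarrow> real) \<Rightarrow> bool" where
  "Ck 0 \<phi> \<longleftrightarrow> continuous_on UNIV \<phi>"
| "Ck (Suc k) \<phi> \<longleftrightarrow> (\<forall>x. \<phi> differentiable (at x)) \<and>
     (\<forall>b\<in>Basis. Ck k (\<lambda>x. frechet_derivative \<phi> (at x) b))"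

definition test_functions :: "'a::euclidean_space set \<Rightarrow> ('a \<Rightarrow> real) set" where
  "test_functions \<Omega> = {\<phi>. (\<forall>k. Ck k \<phi>) \<and> compact (closure {x. \<phi> x \<noteq> 0}) \<and>
                         closure {x. \<phi> x \<noteq> 0} \<subseteq> \<Omega>}"

definition classical_grad :: "('a::euclidean_space \<Rightarrow> real) \<Rightarrow> 'a \<Rightarrow> 'a" where
  "classical_grad \<phi> x = (\<Sum>b\<in>Basis. frechet_derivative \<phi> (at x) b *\<^sub>R b)"

definition is_weak_grad ::
  "'a::euclidean_space set \<Rightarrow> ('a \<Rightarrow> real) \<Rightarrow> ('a \<Rightarrow> 'a) \<Rightarrow> bool" where
  "is_weak_grad \<Omega> v g \<longleftrightarrow> g \<in> L2 \<Omega> \<and>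
     (\<forall>\<phi>\<in>test_functions \<Omega>. \<forall>b\<in>Basis.
        (LINT x|lebesgue_on \<Omega>. v x * (classical_grad \<phi> x \<bullet> b)) =
        - (LINT x|lebesgue_on \<Omega>. (g x \<bullet> b) * \<phi> x))"

definition H1 :: "'a::euclidean_space set \<Rightarrow> ('a \<Rightarrow> real) set" where
  "H1 \<Omega> = {v \<in> L2 \<Omega>. \<exists>g. is_weak_grad \<Omega> v g}"

text \<open>Weak gradients are unique only up to almost everywhere equality on \<open>\<Omega>\<close>, hence the choice
  of a representative.\<close>

definition weak_grad :: "'a::euclidean_space set \<Rightarrow> ('a \<Rightarrow> real) \<Rightarrow> 'a \<Rightarrow> 'a" where
  "weak_grad \<Omega> v = (SOME g. is_weak_grad \<Omega> v g)"

definition H1_norm :: "'a::euclidean_space set \<Rightarrow> ('a \<Rightarrow> real) \<Rightarrow> real" where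
  "H1_norm \<Omega> v = sqrt ((L2_norm \<Omega> v)\<^sup>2 + (L2_norm \<Omega> (weak_grad \<Omega> v))\<^sup>2)"

definition H10 :: "'a::euclidean_space set \<Rightarrow> ('a \<Rightarrow> real) set" where
  "H10 \<Omega> = {v \<in> H1 \<Omega>. \<forall>e>0. \<exists>\<phi>\<in>test_functions \<Omega>. H1_norm \<Omega> (\<lambda>x. v x - \<phi> x) < e}"


section \<open>Functions of time with values in \<open>L\<^sup>2\<close>\<close>

text \<open>Functions on \<open>[0,\<infinity>)\<close> are evaluated pointwise in time: the supremum is a genuine supremum, not
  an essential one, and the BV norm is the total variation alone.\<close>

definition Linf_norm :: "'a::euclidean_space set \<Rightarrow> (real \<Rightarrow> 'a \<Rightarrow> real) \<Rightarrow> real" where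
  "Linf_norm \<Omega> f = (SUP s\<in>{0..}. L2_norm \<Omega> (f s))"

definition Linf_L2 :: "'a::euclidean_space set \<Rightarrow> (real \<Rightarrow> 'a \<Rightarrow> real) set" where
  "Linf_L2 \<Omega> = {f. (\<forall>s\<ge>0. f s \<in> L2 \<Omega>) \<and> bdd_above ((\<lambda>s. L2_norm \<Omega> (f s)) ` {0..})}"

definition variation_sums :: "'a::euclidean_space set \<Rightarrow> (real \<Rightarrow> 'a \<Rightarrow> real) \<Rightarrow> real set" where
  "variation_sums \<Omega> f =
     {(\<Sum>i=1..N. L2_norm \<Omega> (\<lambda>x. f (s i) x - f (s (i - 1)) x)) |
        (s :: nat \<Rightarrow> real) (N :: nat). 0 \<le> s 0 \<and> (\<forall>i\<in>{1..N}. s (i - 1) < s i)}"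

definition BV_norm :: "'a::euclidean_space set \<Rightarrow> (real \<Rightarrow> 'a \<Rightarrow> real) \<Rightarrow> real" where
  "BV_norm \<Omega> f = Sup (variation_sums \<Omega> f)"

definition BV_L2 :: "'a::euclidean_space set \<Rightarrow> (real \<Rightarrow> 'a \<Rightarrow> real) set" where
  "BV_L2 \<Omega> = {f. (\<forall>s\<ge>0. f s \<in> L2 \<Omega>) \<and> bdd_above (variation_sums \<Omega> f)}"


section \<open>The fast L2-1\<open>\<^sub>\<sigma>\<close> operator\<close>

definition tau :: "(nat \<Rightarrow> real) \<Rightarrow> nat \<Rightarrow> real" where
  "tau t k = t k - t (k - 1)"

definition tstar :: "real \<Rightarrow> (nat \<Rightarrow> real) \<Rightarrow> nat \<Rightarrow> real" where
  "tstar \<sigma> t k = t (k - 1) + \<sigma> * tau t k"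

definition soe :: "nat \<Rightarrow> (nat \<Rightarrow> real) \<Rightarrow> (nat \<Rightarrow> real) \<Rightarrow> real \<Rightarrow> real" where
  "soe Nq \<theta> \<omega> s = (\<Sum>l=1..Nq. \<omega> l * exp (- \<theta> l * s))"

text \<open>In the coefficients, \<open>K\<close> is the approximate kernel, \<open>k\<close> the time level (the superscript) and \<open>j\<close>
  the subscript.\<close>

definition a_hat ::
  "(real \<Rightarrow> real) \<Rightarrow> real \<Rightarrow> (nat \<Rightarrow> real) \<Rightarrow> nat \<Rightarrow> nat \<Rightarrow> real" where
  "a_hat K \<sigma> t k j = integral {t (j - 1)..t j}
     (\<lambda>s. (2 * s - t j - t (j + 1)) / (tau t j * (tau t j + tau t (j + 1))) * K (tstar \<sigma> t k - s))"

definition c_hat ::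
  "(real \<Rightarrow> real) \<Rightarrow> real \<Rightarrow> (nat \<Rightarrow> real) \<Rightarrow> nat \<Rightarrow> nat \<Rightarrow> real" where
  "c_hat K \<sigma> t k j = (if j = 0 then 0 else integral {t (j - 1)..t j}
     (\<lambda>s. (2 * s - t (j - 1) - t j) / (tau t (j + 1) * (tau t j + tau t (j + 1)))
          * K (tstar \<sigma> t k - s)))"

definition d_hat ::
  "(real \<Rightarrow> real) \<Rightarrow> real \<Rightarrow> (nat \<Rightarrow> real) \<Rightarrow> nat \<Rightarrow> nat \<Rightarrow> real" where
  "d_hat K \<sigma> t k j = c_hat K \<sigma> t k (j - 1) - a_hat K \<sigma> t k j"

definition fast_L21sigma ::
  "(real \<Rightarrow> real) \<Rightarrow> real \<Rightarrow> real \<Rightarrow> (nat \<Rightarrow> real) \<Rightarrow> (nat \<Rightarrow> 'a \<Rightarrow> real) \<Rightarrow> nat \<Rightarrow> 'a \<Rightarrow> real" where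
  "fast_L21sigma K \<alpha> \<sigma> t u k x =
     1 / Gamma (1 - \<alpha>) *
       (c_hat K \<sigma> t k (k - 1) * (u k x - u (k - 1) x)
        + (\<Sum>j=1..k - 1. d_hat K \<sigma> t k j * (u j x - u (j - 1) x)))
     + \<sigma> powr (1 - \<alpha>) / (Gamma (2 - \<alpha>) * tau t k powr \<alpha>) * (u k x - u (k - 1) x)"

definition eta :: real where
  "eta = (THE \<rho>. 0 < \<rho> \<and> 1 - 3 * \<rho>\<^sup>2 * (1 + \<rho>) = 0)"

lemma eta_ex1: "\<exists>!\<rho>::real. 0 < \<rho> \<and> 1 - 3 * \<rho>\<^sup>2 * (1 + \<rho>) = 0"
proof -
  let ?p = "\<lambda>\<rho>::real. 3 * \<rho>\<^sup>2 * (1 + \<rho>)"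
  have "\<exists>x\<ge>0. x \<le> 1 \<and> ?p x = 1"
    by (rule IVT') (auto intro!: continuous_intros)
  then obtain x where x: "x \<ge> 0" "?p x = 1" by auto
  have mono: "?p a < ?p b" if "0 < a" "a < b" for a b
  proof -
    have "a\<^sup>2 * (1 + a) < b\<^sup>2 * (1 + b)"
      using that by (intro mult_strict_mono power_strict_mono) auto
    then show ?thesis by simp
  qed
  show ?thesis
  proof (rule ex1I[of _ x])
    show "0 < x \<and> 1 - ?p x = 0" using x by (cases "x = 0") auto
    fix y assume y: "0 < y \<and> 1 - ?p y = 0"
    show "y = x"
      using mono[of y x] mono[of x y] x y \<open>0 < x \<and> 1 - ?p x = 0\<close>
      by (cases y x rule: linorder_cases) auto
  qed
qed

end

theory Submission
  imports Defs
begin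

text \<open>
  The estimate is an energy argument. Testing the scheme at level \<open>k\<close> with the increment
  \<open>\<delta>\<^sub>k u = u k - u (k - 1)\<close> turns the elliptic term into at least half the increase of
  \<open>\<parallel>\<nabla>u\<parallel>\<^sup>2\<close>, because the weight \<open>1 - \<alpha>/2\<close> on the new level exceeds one half (\<open>gradient_step\<close>).
  Summing over \<open>k\<close>, two things remain: the source term, which summation by parts bounds by
  \<open>(2 \<parallel>f\<parallel>\<^sub>\<infinity> + \<parallel>f\<parallel>\<^sub>B\<^sub>V) C\<^sub>\<Omega>\<close> times the largest gradient norm met so far (\<open>source_term_le\<close>),
  and the history term \<open>\<Sum>\<^sub>k \<langle>F\<^sub>k u, \<delta>\<^sub>k u\<rangle>\<close>, which has to be nonnegative. Evaluating at
  the level where the gradient norm is largest then closes the estimate (\<open>max_step_bound\<close>).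

  Nonnegativity of the history term is a statement about a real quadratic form, applied pointwise
  in space (\<open>fast_form_nonneg\<close>). Since the kernel is a sum of exponentials, the coefficient
  \<open>d_hat\<close> at \<open>(k, j)\<close> splits into modes \<open>\<omega> e\<^sub>k D\<^sub>j\<close> with \<open>e\<^sub>k = exp (- \<theta> t\<^sub>k\<^sup>*)\<close> decreasing in
  \<open>k\<close>. If \<open>D\<close> is increasing, each mode is nonnegative once the diagonal entries
  \<open>(e\<^sub>k D\<^bsub>k-1\<^esub> + e\<^bsub>k+1\<^esub> (D\<^sub>k - D\<^bsub>k-1\<^esub>)) / 2\<close> are added (\<open>semiseparable_form_nonneg\<close>): writing
  \<open>D\<close> as a sum of its increments reduces the form to \<open>x\<^sub>k V\<^bsub>k-1\<^esub>\<close> for partial sums \<open>V\<close>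
  of \<open>x\<close>, which telescopes.

  That \<open>D\<close> is increasing is where the step ratio enters: the powers \<open>exp (\<theta> t\<^sub>j)\<close> separate consecutive
  values, \<open>D\<^sub>j \<le> exp (\<theta> t\<^sub>j) \<le> D\<^bsub>j+1\<^esub>\<close>. Up to the factor \<open>exp (\<theta> t\<^bsub>j-1\<^esub>)\<close>, the upper
  bound compares a gain of \<open>\<theta> \<tau>\<^sub>j / 2\<close> with a loss of \<open>\<theta> \<tau>\<^bsub>j-1\<^esub>\<^sup>3 / (6 \<tau>\<^sub>j (\<tau>\<^bsub>j-1\<^esub> + \<tau>\<^sub>j))\<close>, and these balance exactly when
  \<open>3 \<rho>\<^sup>2 (1 + \<rho>) = 1\<close>. That the local term of the scheme pays for the added diagonal is where the accuracy
  of the exponential sum \<open>K\<close> enters: for \<open>k \<ge> 2\<close>, after summation over the modes, twice this diagonal exceeds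
  twice the entry \<open>c_hat\<close> of the scheme by at most \<open>K (\<sigma> \<tau>\<^sub>k) + K (\<sigma> \<tau>\<^bsub>k+1\<^esub>) / 2\<close>, and \<open>K\<close> is close to \<open>s powr - \<alpha>\<close> at these two points
  (\<open>diagonal_budget\<close>).

  The functional-analytic part supplies what the test by \<open>\<delta>\<^sub>k u\<close> presupposes: weak gradients
  are unique almost everywhere, hence linear, and \<open>H10\<close> is closed under differences. Both rest on explicit
  smooth bumps supported in boxes and on the vanishing of integrals of directional derivatives.
\<close>

section \<open>Integrals of exponentials against the interpolation weights\<close>

text \<open>The weight of the coefficient \<open>a_hat\<close> on a step \<open>[a, b]\<close> followed by a step of length \<open>r\<close> is, up to sign, a
probability density that decreases along the step. Its mass and its mean are all that the estimates below
use of it; both are read off by integrating affine functions.\<close>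

lemma affine_density_integral:
  fixes a b r u v :: real
  assumes "a < b" "0 < r"
  shows "((\<lambda>s. (2 * b + r - 2 * s) / ((b - a) * (b - a + r)) * (u + v * (s - a)))
    has_integral u + v * ((b - a) * (2 * (b - a) + 3 * r) / (6 * (b - a + r)))) {a..b}"
proof -
  define p where "p = b - a"
  define H where "H s = ((2 * p + r) * u * (s - a) + ((2 * p + r) * v - 2 * u) * (s - a)\<^sup>2 / 2
     - 2 * v * (s - a) ^ 3 / 3) / (p * (p + r))" for s
  have p: "p > 0" "p + r > 0" using assms by (auto simp: p_def)
  have "((\<lambda>s. (2 * b + r - 2 * s) / ((b - a) * (b - a + r)) * (u + v * (s - a)))
    has_integral H b - H a) {a..b}"
  proof (rule fundamental_theorem_of_calculus)
    show "a \<le> b" using assms by simp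
    fix s
    have "(H has_real_derivative ((2 * p + r) * u + ((2 * p + r) * v - 2 * u) * (s - a)
       - 2 * v * (s - a)\<^sup>2) / (p * (p + r))) (at s within {a..b})"
      unfolding H_def using p by (auto intro!: derivative_eq_intros simp: power2_eq_square)
    moreover have "((2 * p + r) * u + ((2 * p + r) * v - 2 * u) * (s - a)
       - 2 * v * (s - a)\<^sup>2) = (2 * b + r - 2 * s) * (u + v * (s - a))"
      unfolding p_def by (simp add: algebra_simps power2_eq_square)
    ultimately show "(H has_vector_derivative (2 * b + r - 2 * s) / ((b - a) * (b - a + r)) * (u + v * (s - a)))
        (at s within {a..b})"
      by (simp add: has_real_derivative_iff_has_vector_derivative p_def)
  qed
  moreover have "H a = 0" by (simp add: H_def)
  moreover have "H b = u + v * (p * (2 * p + 3 * r) / (6 * (p + r)))"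
    unfolding H_def p_def[symmetric] using p
    by (simp add: divide_simps power2_eq_square power3_eq_cube) (simp add: algebra_simps)
  ultimately show ?thesis by (simp add: p_def)
qed

text \<open>Since the density decreases, its mean lies in the left half of the step, so an increasing affine
majorant may be evaluated at the midpoint.\<close>

lemma density_average_le:
  fixes a b r u v :: real
  assumes "a < b" "0 < r" and \<phi>: "continuous_on {a..b} \<phi>"
    and le: "\<And>s. a \<le> s \<Longrightarrow> s \<le> b \<Longrightarrow> \<phi> s \<le> u + v * (s - a)" and "0 \<le> v"
  shows "integral {a..b} (\<lambda>s. (2 * b + r - 2 * s) / ((b - a) * (b - a + r)) * \<phi> s)
     \<le> u + v * (b - a) / 2"
proof -
  have "integral {a..b} (\<lambda>s. (2 * b + r - 2 * s) / ((b - a) * (b - a + r)) * \<phi> s)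
     \<le> u + v * ((b - a) * (2 * (b - a) + 3 * r) / (6 * (b - a + r)))"
  proof (rule has_integral_le[OF integrable_integral affine_density_integral])
    show "(\<lambda>s. (2 * b + r - 2 * s) / ((b - a) * (b - a + r)) * \<phi> s) integrable_on {a..b}"
      by (intro integrable_continuous_real continuous_intros \<phi>) (use assms in auto)
    fix s assume "s \<in> {a..b}"
    then show "(2 * b + r - 2 * s) / ((b - a) * (b - a + r)) * \<phi> s
        \<le> (2 * b + r - 2 * s) / ((b - a) * (b - a + r)) * (u + v * (s - a))"
      using assms by (intro mult_left_mono le divide_nonneg_nonneg) auto
  qed (use assms in auto)
  also have "(b - a) * (2 * (b - a) + 3 * r) / (6 * (b - a + r)) \<le> (b - a) / 2"
    using assms by (simp add: divide_simps)
  then have "u + v * ((b - a) * (2 * (b - a) + 3 * r) / (6 * (b - a + r))) \<le> u + v * (b - a) / 2"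
    using mult_left_mono[OF _ \<open>0 \<le> v\<close>] by fastforce
  finally show ?thesis .
qed

lemma density_average_ge:
  fixes a b r u :: real
  assumes "a < b" "0 < r" and \<phi>: "continuous_on {a..b} \<phi>"
    and le: "\<And>s. a \<le> s \<Longrightarrow> s \<le> b \<Longrightarrow> u \<le> \<phi> s"
  shows "u \<le> integral {a..b} (\<lambda>s. (2 * b + r - 2 * s) / ((b - a) * (b - a + r)) * \<phi> s)"
proof -
  have "u + 0 * ((b - a) * (2 * (b - a) + 3 * r) / (6 * (b - a + r)))
     \<le> integral {a..b} (\<lambda>s. (2 * b + r - 2 * s) / ((b - a) * (b - a + r)) * \<phi> s)"
  proof (rule has_integral_le[OF affine_density_integral integrable_integral])
    show "(\<lambda>s. (2 * b + r - 2 * s) / ((b - a) * (b - a + r)) * \<phi> s) integrable_on {a..b}"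
      by (intro integrable_continuous_real continuous_intros \<phi>) (use assms in auto)
    fix s assume "s \<in> {a..b}"
    then show "(2 * b + r - 2 * s) / ((b - a) * (b - a + r)) * (u + 0 * (s - a))
       \<le> (2 * b + r - 2 * s) / ((b - a) * (b - a + r)) * \<phi> s"
      using assms by (intro mult_left_mono divide_nonneg_nonneg) auto
  qed (use assms in auto)
  then show ?thesis by simp
qed

lemma exp_above_tangent: "exp (x::real) * (1 + (y - x)) \<le> exp y"
proof -
  have "exp x * (1 + (y - x)) \<le> exp x * exp (y - x)"
    by (intro mult_left_mono exp_ge_add_one_self) auto
  then show ?thesis by (simp flip: exp_add)
qed

lemma exp_below_chord:
  fixes \<theta> a b s :: real
  assumes "a < b" "a \<le> s" "s \<le> b"
  shows "exp (\<theta> * s) \<le> exp (\<theta> * a) + (exp (\<theta> * b) - exp (\<theta> * a)) / (b - a) * (s - a)"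
proof -
  define l where "l = (s - a) / (b - a)"
  have l: "0 \<le> l" "l \<le> 1" "s = (1 - l) * a + l * b"
    using assms by (auto simp: l_def divide_simps) (simp add: algebra_simps)
  have "convex_on UNIV (exp :: real \<Rightarrow> real)"
    by (rule exp_convex)
  from convex_onD[OF this l(1,2), of "\<theta> * a" "\<theta> * b"]
  have "exp (\<theta> * s) \<le> (1 - l) * exp (\<theta> * a) + l * exp (\<theta> * b)"
    by (simp add: l(3) algebra_simps)
  moreover have "(exp (\<theta> * b) - exp (\<theta> * a)) / (b - a) * (s - a) = (exp (\<theta> * b) - exp (\<theta> * a)) * l"
    by (simp add: l_def)
  ultimately show ?thesis by (simp add: algebra_simps)
qed

text \<open>The weight \<open>2 s - a - b\<close> is odd about the midpoint of the step and the exponential is larger on the side where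
the weight is positive: replacing the exponential by its midpoint value only decreases the integrand.\<close>

lemma centred_moment_nonneg:
  fixes a b \<theta> :: real
  assumes "a \<le> b" "0 \<le> \<theta>"
  shows "0 \<le> integral {a..b} (\<lambda>s. (2 * s - a - b) * exp (\<theta> * s))"
proof (rule has_integral_le[OF _ integrable_integral])
  define H where "H s = (s - a) * (s - b) * exp (\<theta> * ((a + b) / 2))" for s
  have "((\<lambda>s. (2 * s - a - b) * exp (\<theta> * ((a + b) / 2))) has_integral H b - H a) {a..b}"
    by (rule fundamental_theorem_of_calculus)
      (use assms in \<open>auto simp: H_def[abs_def] algebra_simps
        has_real_derivative_iff_has_vector_derivative[symmetric] intro!: derivative_eq_intros\<close>)
  then show "((\<lambda>s. (2 * s - a - b) * exp (\<theta> * ((a + b) / 2))) has_integral 0) {a..b}"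
    by (simp add: H_def)
  show "(\<lambda>s. (2 * s - a - b) * exp (\<theta> * s)) integrable_on {a..b}"
    by (intro integrable_continuous_real continuous_intros)
  fix s assume "s \<in> {a..b}"
  show "(2 * s - a - b) * exp (\<theta> * ((a + b) / 2)) \<le> (2 * s - a - b) * exp (\<theta> * s)"
  proof (cases "2 * s - a - b \<ge> 0")
    case True
    then have "\<theta> * ((a + b) / 2) \<le> \<theta> * s" using assms by (intro mult_left_mono) auto
    with True show ?thesis by (intro mult_left_mono) auto
  next
    case False
    then have "\<theta> * s \<le> \<theta> * ((a + b) / 2)" using assms by (intro mult_left_mono) auto
    with False show ?thesis by (intro mult_left_mono_neg) auto
  qed
qed

text \<open>The weight is the derivative of \<open>(s - a) (s - b)\<close>; integration by parts leaves
\<open>\<theta> (s - a) (b - s) exp (\<theta> s)\<close>, where the exponential is at most its value at \<open>b\<close>.\<close>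

lemma centred_moment_le:
  fixes a b \<theta> :: real
  assumes "a \<le> b" "0 \<le> \<theta>"
  shows "integral {a..b} (\<lambda>s. (2 * s - a - b) * exp (\<theta> * s)) \<le> \<theta> * exp (\<theta> * b) * (b - a) ^ 3 / 6"
proof (rule has_integral_le[OF integrable_integral])
  define H where "H s = (s - a) * (s - b) * exp (\<theta> * s)
      + \<theta> * exp (\<theta> * b) * ((b - a) * (s - a)\<^sup>2 / 2 - (s - a) ^ 3 / 3)" for s
  have "((\<lambda>s. (2 * s - a - b) * exp (\<theta> * s) + \<theta> * (s - a) * (s - b) * exp (\<theta> * s)
      + \<theta> * exp (\<theta> * b) * ((s - a) * (b - s))) has_integral H b - H a) {a..b}"
  proof (rule fundamental_theorem_of_calculus)
    show "a \<le> b" by fact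
    fix s
    have "(H has_real_derivative ((s - a) + (s - b)) * exp (\<theta> * s) + (s - a) * (s - b) * (exp (\<theta> * s) * \<theta>)
        + \<theta> * exp (\<theta> * b) * ((b - a) * (s - a) - (s - a)\<^sup>2)) (at s within {a..b})"
      unfolding H_def[abs_def]
      by (rule derivative_eq_intros refl | simp)+ (simp add: field_simps power2_eq_square)
    then show "(H has_vector_derivative (2 * s - a - b) * exp (\<theta> * s) + \<theta> * (s - a) * (s - b) * exp (\<theta> * s)
      + \<theta> * exp (\<theta> * b) * ((s - a) * (b - s))) (at s within {a..b})"
      unfolding has_real_derivative_iff_has_vector_derivative[symmetric]
      by (rule back_subst) (simp add: algebra_simps power2_eq_square)
  qed
  moreover have "H b - H a = \<theta> * exp (\<theta> * b) * (b - a) ^ 3 / 6"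
    by (simp add: H_def power2_eq_square power3_eq_cube)
  ultimately show "((\<lambda>s. (2 * s - a - b) * exp (\<theta> * s) + \<theta> * (s - a) * (s - b) * exp (\<theta> * s)
      + \<theta> * exp (\<theta> * b) * ((s - a) * (b - s))) has_integral \<theta> * exp (\<theta> * b) * (b - a) ^ 3 / 6) {a..b}"
    by simp
  show "(\<lambda>s. (2 * s - a - b) * exp (\<theta> * s)) integrable_on {a..b}"
    by (intro integrable_continuous_real continuous_intros)
  fix s assume s: "s \<in> {a..b}"
  have "\<theta> * ((s - a) * (b - s)) * exp (\<theta> * s) \<le> \<theta> * ((s - a) * (b - s)) * exp (\<theta> * b)"
    using s assms by (intro mult_left_mono) (auto intro: mult_left_mono)
  then show "(2 * s - a - b) * exp (\<theta> * s) \<le> (2 * s - a - b) * exp (\<theta> * s)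
     + \<theta> * (s - a) * (s - b) * exp (\<theta> * s) + \<theta> * exp (\<theta> * b) * ((s - a) * (b - s))"
    by (simp add: algebra_simps)
qed

section \<open>Quadratic forms with a semiseparable kernel\<close>

text \<open>With \<open>V i n = x i + \<dots> + x n\<close> and \<open>H n = (\<Sum>i=1..n. (D i - D (i - 1)) * (V i n)\<^sup>2)\<close>, the form truncated
at \<open>n\<close> is at least \<open>e (n + 1) * H n / 2\<close>. This energy is kept through the induction: passing from \<open>n\<close> to
\<open>n + 1\<close> changes \<open>H\<close> by exactly the new cross terms and squares, and lowering the factor from \<open>e (n + 1)\<close> to
\<open>e (n + 2)\<close> only loses energy because \<open>H\<close> is a sum of nonnegative terms.\<close>

lemma semiseparable_form_nonneg:
  fixes e D x :: "nat \<Rightarrow> real"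
  assumes e0: "\<And>k. 0 \<le> e k" and e: "\<And>k. 1 \<le> k \<Longrightarrow> e (Suc k) \<le> e k"
    and D: "\<And>k. D k \<le> D (Suc k)" and D0: "D 0 = 0"
  shows "0 \<le> (\<Sum>k=1..n. x k * (\<Sum>j=1..k - 1. e k * D j * x j)
     + (e k * D (k - 1) + e (Suc k) * (D k - D (k - 1))) / 2 * (x k)\<^sup>2)"
proof -
  define V where "V i n = (\<Sum>j=i..n. x j)" for i n
  define H where "H n = (\<Sum>i=1..n. (D i - D (i - 1)) * (V i n)\<^sup>2)" for n
  have \<delta>: "0 \<le> D i - D (i - 1)" for i
    using D[of "i - 1"] by (cases i) auto
  have tele: "(\<Sum>i=1..n. D i - D (i - 1)) = D n" for n
    by (induction n) (auto simp: D0)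
  have V_Suc: "V i (Suc n) = V i n + x (Suc n)" if "i \<le> Suc n" for i n
    using that by (simp add: V_def)
  have S: "(\<Sum>i=1..n. (D i - D (i - 1)) * V i n) = (\<Sum>j=1..n. D j * x j)" for n
  proof (induction n)
    case (Suc n)
    have "(\<Sum>i=1..Suc n. (D i - D (i - 1)) * V i (Suc n))
       = (\<Sum>i=1..n. (D i - D (i - 1)) * V i n) + (\<Sum>i=1..Suc n. (D i - D (i - 1)) * x (Suc n))"
      by (simp add: V_Suc distrib_left sum.distrib) (simp add: V_def)
    also have "(\<Sum>i=1..Suc n. (D i - D (i - 1)) * x (Suc n)) = D (Suc n) * x (Suc n)"
      by (simp only: sum_distrib_right[symmetric] tele)
    finally show ?case using Suc by simp
  qed simp
  have H_Suc: "H (Suc n) = H n + 2 * x (Suc n) * (\<Sum>j=1..n. D j * x j) + D n * (x (Suc n))\<^sup>2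
      + (D (Suc n) - D n) * (x (Suc n))\<^sup>2" for n
  proof -
    have "H (Suc n) = (\<Sum>i=1..n. (D i - D (i - 1)) * (V i n + x (Suc n))\<^sup>2)
        + (D (Suc n) - D n) * (x (Suc n))\<^sup>2"
      by (simp add: H_def V_Suc) (simp add: V_def)
    also have "(\<Sum>i=1..n. (D i - D (i - 1)) * (V i n + x (Suc n))\<^sup>2)
       = (\<Sum>i=1..n. (D i - D (i - 1)) * (V i n)\<^sup>2) + 2 * x (Suc n) * (\<Sum>i=1..n. (D i - D (i - 1)) * V i n)
        + (\<Sum>i=1..n. D i - D (i - 1)) * (x (Suc n))\<^sup>2"
      unfolding sum_distrib_left sum_distrib_right sum.distrib[symmetric]
      by (rule sum.cong) (auto simp: power2_eq_square algebra_simps)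
    finally show ?thesis by (simp add: S[simplified] tele[simplified] H_def)
  qed
  \<comment> \<open>The part of \<open>H (Suc n)\<close> with \<open>i \<le> n\<close>; the term with \<open>i = Suc n\<close> is already weighted with \<open>e (Suc (Suc n))\<close> on the diagonal.\<close>
  have old: "0 \<le> H (Suc n) - (D (Suc n) - D n) * (x (Suc n))\<^sup>2" for n
    unfolding H_def by (simp add: V_def del: sum.cl_ivl_Suc) (simp, intro sum_nonneg mult_nonneg_nonneg, use \<delta> in auto)
  have "e (Suc n) * H n / 2 \<le> (\<Sum>k=1..n. x k * (\<Sum>j=1..k - 1. e k * D j * x j)
     + (e k * D (k - 1) + e (Suc k) * (D k - D (k - 1))) / 2 * (x k)\<^sup>2)"
  proof (induction n)
    case 0
    then show ?case by (simp add: H_def)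
  next
    case (Suc n)
    let ?n = "Suc n"
    define S where "S = (\<Sum>j=1..n. D j * x j)"
    have eS: "(\<Sum>j=1..n. e ?n * D j * x j) = e ?n * S"
      by (simp add: S_def sum_distrib_left mult.assoc)
    have "e (Suc ?n) * (H ?n - (D ?n - D n) * (x ?n)\<^sup>2) \<le> e ?n * (H ?n - (D ?n - D n) * (x ?n)\<^sup>2)"
      by (intro mult_right_mono e old) auto
    moreover have "H ?n = H n + 2 * x ?n * S + D n * (x ?n)\<^sup>2 + (D ?n - D n) * (x ?n)\<^sup>2"
      by (simp only: H_Suc S_def)
    ultimately have "e (Suc ?n) * H ?n / 2 \<le> e ?n * H n / 2
       + (x ?n * (e ?n * S) + (e ?n * D n + e (Suc ?n) * (D ?n - D n)) / 2 * (x ?n)\<^sup>2)"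
      by (simp add: field_simps)
    with Suc show ?case
      by (simp add: eS[simplified])
  qed
  moreover have "0 \<le> H n" unfolding H_def using \<delta> by (auto intro!: sum_nonneg)
  ultimately show ?thesis
    using e0[of "Suc n"] by (smt (verit, best) divide_nonneg_nonneg mult_nonneg_nonneg)
qed

section \<open>Exponential modes of the coefficients\<close>

text \<open>For a single mode \<open>exp (- \<theta> s)\<close> the dependence of the coefficients on the time level \<open>k\<close> is the factor
\<open>exp (- \<theta> t\<^sub>k\<^sup>*)\<close>. What is left depends on the mesh near \<open>t\<^sub>j\<close> only: \<open>A_exp\<close>, \<open>C_exp\<close> and \<open>D_exp\<close> are the
remaining factors of \<open>- a_hat\<close>, \<open>c_hat\<close> and \<open>d_hat\<close>. The value \<open>D_exp t \<theta> 0 = 0\<close> makes increments of \<open>D_exp\<close>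
meaningful from the first step on.\<close>

definition A_exp :: "(nat \<Rightarrow> real) \<Rightarrow> real \<Rightarrow> nat \<Rightarrow> real" where
  "A_exp t \<theta> j = integral {t (j - 1)..t j} (\<lambda>s. (2 * t j + tau t (j + 1) - 2 * s)
      / ((t j - t (j - 1)) * (t j - t (j - 1) + tau t (j + 1))) * exp (\<theta> * s))"

definition C_exp :: "(nat \<Rightarrow> real) \<Rightarrow> real \<Rightarrow> nat \<Rightarrow> real" where
  "C_exp t \<theta> j = (if j = 0 then 0 else
     integral {t (j - 1)..t j} (\<lambda>s. (2 * s - t (j - 1) - t j) * exp (\<theta> * s))
       / (tau t (j + 1) * (tau t j + tau t (j + 1))))"

definition D_exp :: "(nat \<Rightarrow> real) \<Rightarrow> real \<Rightarrow> nat \<Rightarrow> real" where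
  "D_exp t \<theta> j = (if j = 0 then 0 else C_exp t \<theta> (j - 1) + A_exp t \<theta> j)"

lemma integral_soe:
  fixes g :: "real \<Rightarrow> real"
  assumes "continuous_on {a..b} g"
  shows "integral {a..b} (\<lambda>s. g s * soe Nq \<theta> \<omega> (T - s))
    = (\<Sum>l=1..Nq. \<omega> l * exp (- \<theta> l * T) * integral {a..b} (\<lambda>s. g s * exp (\<theta> l * s)))"
proof -
  have "g s * soe Nq \<theta> \<omega> (T - s)
      = (\<Sum>l=1..Nq. (\<omega> l * exp (- \<theta> l * T)) * (g s * exp (\<theta> l * s)))" for s
    unfolding soe_def sum_distrib_left
    by (rule sum.cong) (auto simp: algebra_simps simp flip: exp_add)
  then have "integral {a..b} (\<lambda>s. g s * soe Nq \<theta> \<omega> (T - s))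
     = integral {a..b} (\<lambda>s. \<Sum>l=1..Nq. (\<omega> l * exp (- \<theta> l * T)) * (g s * exp (\<theta> l * s)))"
    by simp
  also have "\<dots> = (\<Sum>l=1..Nq. integral {a..b} (\<lambda>s. (\<omega> l * exp (- \<theta> l * T)) * (g s * exp (\<theta> l * s))))"
    by (intro integral_sum integrable_continuous_real continuous_intros assms) auto
  finally show ?thesis by simp
qed

lemma a_hat_soe:
  "a_hat (soe Nq \<theta> \<omega>) \<sigma> t k j
    = - (\<Sum>l=1..Nq. \<omega> l * exp (- \<theta> l * tstar \<sigma> t k) * A_exp t (\<theta> l) j)"
proof -
  have "a_hat (soe Nq \<theta> \<omega>) \<sigma> t k j = integral {t (j - 1)..t j}
      (\<lambda>s. - ((2 * t j + tau t (j + 1) - 2 * s)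
      / ((t j - t (j - 1)) * (t j - t (j - 1) + tau t (j + 1))) * soe Nq \<theta> \<omega> (tstar \<sigma> t k - s)))"
    unfolding a_hat_def
  proof (rule integral_cong)
    fix s
    have "2 * s - t j - t (j + 1) = - (2 * t j + tau t (j + 1) - 2 * s)"
      by (simp add: tau_def)
    then show "(2 * s - t j - t (j + 1)) / (tau t j * (tau t j + tau t (j + 1))) * soe Nq \<theta> \<omega> (tstar \<sigma> t k - s)
      = - ((2 * t j + tau t (j + 1) - 2 * s)
      / ((t j - t (j - 1)) * (t j - t (j - 1) + tau t (j + 1))) * soe Nq \<theta> \<omega> (tstar \<sigma> t k - s))"
      by (simp only: minus_divide_left[symmetric] minus_mult_left tau_def[of t j])
  qed
  also have "\<dots> = - (\<Sum>l=1..Nq. \<omega> l * exp (- \<theta> l * tstar \<sigma> t k) * A_exp t (\<theta> l) j)"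
    unfolding A_exp_def integral_neg
    by (subst integral_soe) (auto simp: divide_inverse intro!: continuous_intros)
  finally show ?thesis .
qed

lemma c_hat_soe:
  "c_hat (soe Nq \<theta> \<omega>) \<sigma> t k j
    = (\<Sum>l=1..Nq. \<omega> l * exp (- \<theta> l * tstar \<sigma> t k) * C_exp t (\<theta> l) j)"
proof (cases "j = 0")
  case False
  let ?d = "tau t (j + 1) * (tau t j + tau t (j + 1))"
  have "c_hat (soe Nq \<theta> \<omega>) \<sigma> t k j = integral {t (j - 1)..t j}
      (\<lambda>s. (2 * s - t (j - 1) - t j) * soe Nq \<theta> \<omega> (tstar \<sigma> t k - s)) / ?d"
    using False by (simp add: c_hat_def)
  also have "\<dots> = (\<Sum>l=1..Nq. \<omega> l * exp (- \<theta> l * tstar \<sigma> t k) * C_exp t (\<theta> l) j)"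
    using False
    by (subst integral_soe) (auto simp: C_exp_def sum_divide_distrib intro!: continuous_intros)
  finally show ?thesis .
qed (simp add: c_hat_def C_exp_def)

lemma d_hat_soe:
  "1 \<le> j \<Longrightarrow> d_hat (soe Nq \<theta> \<omega>) \<sigma> t k j
    = (\<Sum>l=1..Nq. \<omega> l * exp (- \<theta> l * tstar \<sigma> t k) * D_exp t (\<theta> l) j)"
  by (simp add: d_hat_def a_hat_soe c_hat_soe D_exp_def distrib_left sum.distrib)

lemma eta_root: "0 < eta" "3 * eta\<^sup>2 * (1 + eta) = 1"
  using theI'[OF eta_ex1] by (auto simp: eta_def)

text \<open>The only numerical information on \<open>eta\<close> that the diagonal estimate needs.\<close>

lemma eta_ge: "2 / 5 \<le> eta"
proof (rule ccontr)
  assume "\<not> 2 / 5 \<le> eta"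
  then have "eta\<^sup>2 * (1 + eta) \<le> (2 / 5)\<^sup>2 * (1 + 2 / 5)"
    using eta_root by (intro mult_mono power_mono) auto
  with eta_root show False by (simp add: power2_eq_square)
qed

locale ratio_mesh =
  fixes t :: "nat \<Rightarrow> real"
  assumes incr: "\<And>k. 1 \<le> k \<Longrightarrow> t (k - 1) < t k"
    and ratio: "\<And>k. 2 \<le> k \<Longrightarrow> eta \<le> tau t k / tau t (k - 1)"
begin

lemma tau_pos: "1 \<le> k \<Longrightarrow> 0 < tau t k"
  using incr[of k] by (simp add: tau_def)

lemma tau_ratio: "1 \<le> k \<Longrightarrow> eta * tau t k \<le> tau t (k + 1)"
  using ratio[of "k + 1"] tau_pos[of k] by (simp add: pos_le_divide_eq)

text \<open>The inequality \<open>3 \<rho>\<^sup>2 (1 + \<rho>) \<ge> 1\<close> for the step ratio, multiplied by the cube of the previous step.\<close>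

lemma tau_cubed_le:
  assumes "1 \<le> k"
  shows "tau t k ^ 3 \<le> 3 * (tau t (k + 1))\<^sup>2 * (tau t k + tau t (k + 1))"
proof -
  let ?o = "tau t k" and ?p = "tau t (k + 1)"
  have "?o ^ 3 = ?o ^ 3 * (3 * eta\<^sup>2 * (1 + eta))"
    using eta_root by simp
  also have "\<dots> = 3 * (eta * ?o)\<^sup>2 * (?o + eta * ?o)"
    by (simp add: power2_eq_square power3_eq_cube algebra_simps)
  also have "\<dots> \<le> 3 * ?p\<^sup>2 * (?o + ?p)"
    using eta_root tau_ratio[OF assms] tau_pos[of k] assms
    by (intro mult_mono power_mono add_mono) auto
  finally show ?thesis .
qed

lemma A_exp_ge: "1 \<le> j \<Longrightarrow> 0 \<le> \<theta> \<Longrightarrow> exp (\<theta> * t (j - 1)) \<le> A_exp t \<theta> j"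
  unfolding A_exp_def
  by (rule density_average_ge)
    (auto intro!: incr[simplified] tau_pos continuous_intros mult_left_mono)

text \<open>Convexity and a mean in the left half of the step give the trapezoidal rule as an upper bound. The
factor one half at the right end point is what leaves room for the kernel error on the diagonal.\<close>

lemma A_exp_le_trapezoid:
  assumes "1 \<le> j" "0 \<le> \<theta>"
  shows "A_exp t \<theta> j \<le> (exp (\<theta> * t (j - 1)) + exp (\<theta> * t j)) / 2"
proof -
  let ?a = "t (j - 1)" and ?b = "t j"
  have ab: "?a < ?b" using incr assms by blast
  have "A_exp t \<theta> j \<le> exp (\<theta> * ?a) + (exp (\<theta> * ?b) - exp (\<theta> * ?a)) / (?b - ?a) * (?b - ?a) / 2"
    unfolding A_exp_def
  proof (rule density_average_le)
    fix s assume "?a \<le> s" "s \<le> ?b"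
    with ab show "exp (\<theta> * s) \<le> exp (\<theta> * ?a) + (exp (\<theta> * ?b) - exp (\<theta> * ?a)) / (?b - ?a) * (s - ?a)"
      by (rule exp_below_chord)
  qed (use assms ab in \<open>auto intro!: tau_pos continuous_intros divide_nonneg_nonneg mult_left_mono\<close>)
  also have "\<dots> = (exp (\<theta> * ?a) + exp (\<theta> * ?b)) / 2"
    using ab by (simp add: field_simps)
  finally show ?thesis .
qed

text \<open>Bounding the exponential by \<open>exp (\<theta> t\<^sub>j) - \<theta> (t\<^sub>j - s) exp (\<theta> t\<^bsub>j-1\<^esub>)\<close> keeps a gain of order \<open>\<tau>\<^sub>j\<close> against
the value at the right end point.\<close>

lemma A_exp_le_right:
  assumes "1 \<le> j" "0 \<le> \<theta>"
  shows "A_exp t \<theta> j \<le> exp (\<theta> * t j) - \<theta> * exp (\<theta> * t (j - 1)) * tau t j / 2"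
proof -
  let ?a = "t (j - 1)" and ?b = "t j"
  have ab: "?a < ?b" using incr assms by blast
  have "A_exp t \<theta> j \<le> (exp (\<theta> * ?b) - \<theta> * exp (\<theta> * ?a) * (?b - ?a))
     + (\<theta> * exp (\<theta> * ?a)) * (?b - ?a) / 2"
    unfolding A_exp_def
  proof (rule density_average_le)
    fix s assume s: "?a \<le> s" "s \<le> ?b"
    have "exp (\<theta> * ?a) * (\<theta> * (?b - s)) \<le> exp (\<theta> * s) * (\<theta> * (?b - s))"
      using s assms by (intro mult_right_mono) (auto intro: mult_left_mono)
    also have "\<dots> \<le> exp (\<theta> * ?b) - exp (\<theta> * s)"
      using exp_above_tangent[of "\<theta> * s" "\<theta> * ?b"] by (simp add: algebra_simps)
    finally show "exp (\<theta> * s) \<le> exp (\<theta> * ?b) - \<theta> * exp (\<theta> * ?a) * (?b - ?a)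
        + \<theta> * exp (\<theta> * ?a) * (s - ?a)"
      by (simp add: algebra_simps)
  qed (use assms ab in \<open>auto intro!: tau_pos continuous_intros\<close>)
  then show ?thesis by (simp add: tau_def field_simps)
qed

lemma C_exp_nonneg: "0 \<le> \<theta> \<Longrightarrow> 0 \<le> C_exp t \<theta> j"
  using centred_moment_nonneg[of "t (j - 1)" "t j" \<theta>] incr[of j] tau_pos[of j] tau_pos[of "j + 1"]
  by (auto simp: C_exp_def intro!: divide_nonneg_nonneg)

text \<open>The loss caused by the preceding step. The ratio condition is exactly what makes it no larger than the gain in
\<open>A_exp_le_right\<close>.\<close>

lemma C_exp_le:
  assumes "0 \<le> \<theta>"
  shows "C_exp t \<theta> j \<le> \<theta> * exp (\<theta> * t j) * tau t (j + 1) / 2"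
proof (cases "j = 0")
  case False
  then have j: "1 \<le> j" by simp
  let ?o = "tau t j" and ?p = "tau t (j + 1)"
  have pos: "0 < ?o" "0 < ?p" using tau_pos j by auto
  have "C_exp t \<theta> j \<le> (\<theta> * exp (\<theta> * t j) * ?o ^ 3 / 6) / (?p * (?o + ?p))"
    using centred_moment_le[of "t (j - 1)" "t j" \<theta>] incr[OF j] pos assms False
    unfolding C_exp_def if_not_P[OF False] by (intro divide_right_mono) (simp_all add: tau_def[of t j])
  also have "\<dots> \<le> (\<theta> * exp (\<theta> * t j) * (3 * ?p\<^sup>2 * (?o + ?p)) / 6) / (?p * (?o + ?p))"
    using pos assms by (intro divide_right_mono mult_left_mono tau_cubed_le j) auto
  also have "\<dots> = \<theta> * exp (\<theta> * t j) * ?p / 2"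
    using pos by (simp add: divide_simps power2_eq_square)
  finally show ?thesis .
qed (use assms tau_pos[of 1] in \<open>auto simp: C_exp_def\<close>)

text \<open>Consecutive values of \<open>D_exp\<close> are separated by the exponentials at the mesh points. Comparing with these
instead of with each other avoids estimating the difference of two integrals.\<close>

lemma D_exp_le: "1 \<le> j \<Longrightarrow> 0 \<le> \<theta> \<Longrightarrow> D_exp t \<theta> j \<le> exp (\<theta> * t j)"
  using C_exp_le[of \<theta> "j - 1"] A_exp_le_right[of j \<theta>] by (simp add: D_exp_def)

lemma D_exp_ge: "1 \<le> j \<Longrightarrow> 0 \<le> \<theta> \<Longrightarrow> exp (\<theta> * t (j - 1)) \<le> D_exp t \<theta> j"
  using C_exp_nonneg[of \<theta> "j - 1"] A_exp_ge[of j \<theta>] by (simp add: D_exp_def)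

lemma D_exp_mono:
  assumes "0 \<le> \<theta>" shows "D_exp t \<theta> j \<le> D_exp t \<theta> (Suc j)"
proof (cases "j = 0")
  case True
  then show ?thesis using D_exp_ge[of "Suc j" \<theta>] assms
    by (simp add: D_exp_def[of t \<theta> 0]) (meson exp_ge_zero order_trans)
next
  case False
  then show ?thesis using D_exp_ge[of "Suc j" \<theta>] D_exp_le[of j \<theta>] assms by simp
qed

lemma tstar_between:
  assumes "1 \<le> k" "0 < \<sigma>" "\<sigma> < 1"
  shows "t (k - 1) < tstar \<sigma> t k" "tstar \<sigma> t k < t k"
proof -
  have "\<sigma> * tau t k < 1 * tau t k" using assms tau_pos by (intro mult_strict_right_mono) auto
  then show "tstar \<sigma> t k < t k" by (simp add: tstar_def tau_def)
qed (use assms tau_pos[of k] in \<open>auto simp: tstar_def\<close>)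

lemma tstar_less:
  assumes "1 \<le> k" "0 < \<sigma>" "\<sigma> < 1"
  shows "tstar \<sigma> t k < tstar \<sigma> t (Suc k)"
  using tstar_between[OF assms] tstar_between[of "Suc k" \<sigma>] assms by simp

text \<open>The diagonal entry that makes a mode nonnegative, bounded by quantities that sum to \<open>c_hat\<close> and to values of the
kernel. Writing \<open>D\<^sub>k = C\<^bsub>k-1\<^esub> + A\<^sub>k\<close>, the term \<open>D\<^bsub>k-1\<^esub>\<close> has the factor
\<open>e\<^sub>k - e\<^bsub>k+1\<^esub> \<ge> 0\<close> and may be replaced by \<open>exp (\<theta> t\<^bsub>k-1\<^esub>)\<close>, and \<open>A\<^sub>k\<close> by its trapezoidal bound. The
contributions of \<open>exp (\<theta> t\<^bsub>k-1\<^esub>)\<close> at level \<open>k + 1\<close> then have a negative total.\<close>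

lemma mode_diagonal_le:
  fixes \<theta> \<sigma> :: real
  defines "e \<equiv> \<lambda>k. exp (- \<theta> * tstar \<sigma> t k)"
  assumes "2 \<le> k" "0 \<le> \<theta>" "0 < \<sigma>" "\<sigma> < 1"
  shows "e k * D_exp t \<theta> (k - 1) + e (Suc k) * (D_exp t \<theta> k - D_exp t \<theta> (k - 1))
    \<le> 2 * (e k * C_exp t \<theta> (k - 1)) + exp (- \<theta> * (\<sigma> * tau t k))
      + exp (- \<theta> * (\<sigma> * tau t (Suc k))) / 2"
proof -
  define E where "E k = exp (\<theta> * t k)" for k
  have e: "e (Suc k) \<le> e k" "0 < e k" "0 < e (Suc k)"
    using tstar_less[of k \<sigma>] assms by (auto simp: e_def intro!: mult_left_mono)
  let ?C = "C_exp t \<theta> (k - 1)" and ?A = "A_exp t \<theta> k" and ?D = "D_exp t \<theta> (k - 1)"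
  have "D_exp t \<theta> k = ?C + ?A" using assms by (simp add: D_exp_def)
  then have "e k * ?D + e (Suc k) * (D_exp t \<theta> k - ?D)
      = (e k - e (Suc k)) * ?D + e (Suc k) * ?C + e (Suc k) * ?A"
    by (simp add: algebra_simps)
  also have "\<dots> \<le> (e k - e (Suc k)) * E (k - 1) + e k * ?C + e (Suc k) * ((E (k - 1) + E k) / 2)"
    using e assms D_exp_le[of "k - 1" \<theta>] A_exp_le_trapezoid[of k \<theta>] C_exp_nonneg[of \<theta> "k - 1"]
    by (intro add_mono mult_left_mono mult_right_mono) (auto simp: E_def)
  also have "\<dots> \<le> 2 * (e k * ?C) + e k * E (k - 1) + e (Suc k) * E k / 2"
    using e C_exp_nonneg[of \<theta> "k - 1"] assms mult_nonneg_nonneg[of "e k" ?C]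
      mult_nonneg_nonneg[of "e (Suc k)" "E (k - 1)"]
    by (simp add: E_def field_simps)
  also have "e k * E (k - 1) = exp (- \<theta> * (\<sigma> * tau t k))"
    by (simp add: e_def E_def tstar_def algebra_simps flip: exp_add)
  also have "e (Suc k) * E k = exp (- \<theta> * (\<sigma> * tau t (Suc k)))"
    by (simp add: e_def E_def tstar_def algebra_simps flip: exp_add)
  finally show ?thesis .
qed

text \<open>At the first level there is no history, and the diagonal entry is an average of the mode over the first step as seen
from level two.\<close>

lemma first_mode_diagonal_le:
  assumes "0 \<le> \<theta>"
  shows "exp (- \<theta> * tstar \<sigma> t 2) * D_exp t \<theta> 1 \<le> exp (- \<theta> * (\<sigma> * tau t 2))"
proof -
  have "exp (- \<theta> * tstar \<sigma> t 2) * D_exp t \<theta> 1 \<le> exp (- \<theta> * tstar \<sigma> t 2) * exp (\<theta> * t 1)"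
    using D_exp_le[of 1 \<theta>] assms by (intro mult_left_mono) auto
  also have "\<dots> = exp (- \<theta> * (\<sigma> * tau t 2))"
    by (simp add: tstar_def algebra_simps flip: exp_add)
  finally show ?thesis .
qed

end

text \<open>As \<open>r \<ge> 2 q / 5\<close>, the quotient is at most \<open>(5/2) powr \<alpha>\<close>, which is convex in \<open>\<alpha>\<close> and equals \<open>1\<close> and \<open>5/2\<close> at
\<open>\<alpha> = 0\<close> and \<open>\<alpha> = 1\<close>.\<close>

lemma step_ratio_powr_le:
  fixes \<alpha> q r \<sigma> :: real
  assumes "0 < \<alpha>" "\<alpha> < 1" "0 < \<sigma>" "0 < q" "eta * q \<le> r"
  shows "(\<sigma> * r) powr - \<alpha> \<le> (1 + 3 / 2 * \<alpha>) * (\<sigma> * q) powr - \<alpha>"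
proof -
  have "2 / 5 * q \<le> eta * q" using eta_ge assms by (intro mult_right_mono) auto
  then have "2 / 5 * q \<le> r" using assms(5) by (rule order_trans)
  then have "\<sigma> * (2 / 5 * q) \<le> \<sigma> * r" using assms by (intro mult_left_mono) auto
  then have "2 / 5 * (\<sigma> * q) \<le> \<sigma> * r" by (simp add: algebra_simps)
  then have "(\<sigma> * r) powr - \<alpha> \<le> (2 / 5 * (\<sigma> * q)) powr - \<alpha>"
    using assms by (intro powr_mono2') auto
  also have "\<dots> = (2 / 5) powr - \<alpha> * (\<sigma> * q) powr - \<alpha>"
    by (rule powr_mult)
  also have "(2 / 5) powr - \<alpha> \<le> 1 + 3 / 2 * \<alpha>"
  proof -
    have "(2 / 5) powr - \<alpha> = exp (ln (5 / 2) * \<alpha>)"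
      by (simp add: powr_def ln_div algebra_simps)
    also have "\<dots> \<le> exp (ln (5 / 2) * 0) + (exp (ln (5 / 2) * 1) - exp (ln (5 / 2) * 0)) / (1 - 0) * (\<alpha> - 0)"
      using assms by (intro exp_below_chord) auto
    finally show ?thesis by simp
  qed
  then have "(2 / 5) powr - \<alpha> * (\<sigma> * q) powr - \<alpha> \<le> (1 + 3 / 2 * \<alpha>) * (\<sigma> * q) powr - \<alpha>"
    by (intro mult_right_mono) auto
  finally show ?thesis .
qed

section \<open>Positivity of the fast operator\<close>

text \<open>The local term of the scheme pays for the diagonal. In units of \<open>Q = (\<sigma> q) powr - \<alpha>\<close> and after multiplication by
\<open>1 - \<alpha>\<close>, the right-hand side is \<open>2 \<sigma> = 2 - \<alpha>\<close>, each \<open>\<epsilon>\<close> contributes at most \<open>1/5\<close>, and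
\<open>(\<sigma> r) powr - \<alpha>\<close> contributes at most \<open>(1 + 3 \<alpha> / 2) (1 - \<alpha>) \<le> 11/8 - \<alpha>\<close>. The first inequality
serves the levels \<open>k \<ge> 2\<close>, the second one the first level.\<close>

lemma diagonal_budget:
  fixes \<alpha> \<sigma> \<epsilon> q r :: real
  assumes \<alpha>: "0 < \<alpha>" "\<alpha> < 1" and \<sigma>: "\<sigma> = 1 - \<alpha> / 2" and q: "0 < q" "eta * q \<le> r"
    and \<epsilon>: "\<epsilon> \<le> 1 / (5 * (1 - \<alpha>) * (\<sigma> * q) powr \<alpha>)"
  shows "((\<sigma> * q) powr - \<alpha> + \<epsilon>) + ((\<sigma> * r) powr - \<alpha> + \<epsilon>) / 2
      \<le> 2 * (\<sigma> powr (1 - \<alpha>) / ((1 - \<alpha>) * q powr \<alpha>))" (is "?L2 \<le> ?R")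
    and "(\<sigma> * r) powr - \<alpha> + \<epsilon> \<le> 2 * (\<sigma> powr (1 - \<alpha>) / ((1 - \<alpha>) * q powr \<alpha>))" (is "?L1 \<le> _")
proof -
  define Q where "Q = (\<sigma> * q) powr - \<alpha>"
  have \<sigma>0: "0 < \<sigma>" using \<alpha> \<sigma> by simp
  have Q: "0 < Q" using \<sigma>0 q by (simp add: Q_def)
  have R: "?R * (1 - \<alpha>) = (2 - \<alpha>) * Q"
    using \<alpha> \<sigma>0 q by (simp add: Q_def powr_mult powr_minus powr_diff divide_simps) (simp add: \<sigma>)
  have r: "(\<sigma> * r) powr - \<alpha> \<le> (1 + 3 / 2 * \<alpha>) * Q"
    unfolding Q_def using \<alpha> \<sigma>0 q by (intro step_ratio_powr_le)
  have "1 / (5 * (1 - \<alpha>) * (\<sigma> * q) powr \<alpha>) = Q / (5 * (1 - \<alpha>))"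
    by (simp add: Q_def powr_minus divide_simps)
  with \<epsilon> have "\<epsilon> * (5 * (1 - \<alpha>)) \<le> Q"
    using \<alpha> by (simp add: pos_le_divide_eq)
  then have \<epsilon>Q: "\<epsilon> * (1 - \<alpha>) \<le> Q / 5" by (simp add: algebra_simps)
  have quad: "\<alpha> * (1 - \<alpha>) \<le> 1 / 4"
    using zero_le_power2[of "\<alpha> - 1 / 2"] by (simp add: power2_eq_square algebra_simps)
  have rQ: "(\<sigma> * r) powr - \<alpha> * (1 - \<alpha>) \<le> (1 + 3 / 2 * \<alpha>) * Q * (1 - \<alpha>)"
    using r \<alpha> by (intro mult_right_mono) auto
  have rQ': "(1 + 3 / 2 * \<alpha>) * Q * (1 - \<alpha>) \<le> (11 / 8 - \<alpha>) * Q"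
    using mult_right_mono[OF quad, of Q] Q by (simp add: algebra_simps)
  have "?L1 * (1 - \<alpha>) \<le> (11 / 8 - \<alpha>) * Q + Q / 5"
    using order_trans[OF rQ rQ'] \<epsilon>Q unfolding distrib_right by linarith
  also have "\<dots> \<le> (2 - \<alpha>) * Q" using Q by (simp add: algebra_simps)
  finally show "?L1 \<le> ?R" using R \<alpha> by (metis diff_gt_0_iff_gt mult_le_cancel_right_pos)
  have "?L2 * (1 - \<alpha>) \<le> Q * (1 - \<alpha>) + Q / 5 + ((11 / 8 - \<alpha>) * Q + Q / 5) / 2"
  proof -
    have "?L2 * (1 - \<alpha>) = Q * (1 - \<alpha>) + \<epsilon> * (1 - \<alpha>) + ((\<sigma> * r) powr - \<alpha> * (1 - \<alpha>) + \<epsilon> * (1 - \<alpha>)) / 2"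
      by (simp only: Q_def distrib_right times_divide_eq_left)
    also have "\<dots> \<le> Q * (1 - \<alpha>) + Q / 5 + ((11 / 8 - \<alpha>) * Q + Q / 5) / 2"
      by (intro add_mono divide_right_mono order_trans[OF rQ rQ'] \<epsilon>Q) auto
    finally show ?thesis .
  qed
  also have "\<dots> \<le> (2 - \<alpha>) * Q" using Q mult_pos_pos[OF Q \<alpha>(1)]
    by (simp add: algebra_simps add_divide_distrib diff_divide_distrib)
  finally show "?L2 \<le> ?R" using R \<alpha> by (metis diff_gt_0_iff_gt mult_le_cancel_right_pos)
qed

locale fast_mesh = ratio_mesh t for t +
  fixes \<alpha> \<sigma> \<epsilon> \<Delta>t T_soe :: real and Nq :: nat and \<theta> \<omega> :: "nat \<Rightarrow> real"
  assumes alpha: "0 < \<alpha>" "\<alpha> < 1"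
    and sigma: "\<sigma> = 1 - \<alpha> / 2"
    and soe_pos: "\<And>l. l \<in> {1..Nq} \<Longrightarrow> 0 < \<theta> l \<and> 0 < \<omega> l"
    and soe_approx: "\<And>s. s \<in> {\<Delta>t..T_soe} \<Longrightarrow> \<bar>s powr (- \<alpha>) - soe Nq \<theta> \<omega> s\<bar> \<le> \<epsilon>"
    and mesh_eps: "\<And>k. 1 \<le> k \<Longrightarrow> \<epsilon> \<le> 1 / (5 * (1 - \<alpha>) * (\<sigma> * tau t k) powr \<alpha>)"
    and mesh_Delta: "\<And>k. 2 \<le> k \<Longrightarrow> \<Delta>t \<le> \<sigma> * tau t k"
    and mesh_T: "\<And>k. 2 \<le> k \<Longrightarrow> \<sigma> * tau t (k + 1) + tau t k \<le> T_soe"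
begin

abbreviation "K \<equiv> soe Nq \<theta> \<omega>"

lemma sigma_bounds: "0 < \<sigma>" "\<sigma> < 1"
  using alpha sigma by auto

text \<open>The points \<open>\<sigma> \<tau>\<^sub>k\<close> with \<open>k \<ge> 2\<close> lie in the interval on which the kernel is approximated.\<close>

lemma kernel_at_step_le:
  assumes "2 \<le> k"
  shows "K (\<sigma> * tau t k) \<le> (\<sigma> * tau t k) powr - \<alpha> + \<epsilon>"
proof -
  have "0 < tau t k" "0 < tau t (k + 1)" using assms by (auto intro: tau_pos)
  moreover from this have "\<sigma> * tau t k \<le> 1 * tau t k"
    using sigma_bounds by (intro mult_right_mono) auto
  moreover have "0 \<le> \<sigma> * tau t (k + 1)"
    using sigma_bounds \<open>0 < tau t (k + 1)\<close> by (intro mult_nonneg_nonneg) auto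
  ultimately have "\<sigma> * tau t k \<in> {\<Delta>t..T_soe}"
    unfolding atLeastAtMost_iff using mesh_Delta[OF assms] mesh_T[OF assms] by linarith
  from soe_approx[OF this] show ?thesis by simp
qed

text \<open>Twice the diagonal that \<open>semiseparable_form_nonneg\<close> requires, summed over the modes.\<close>

definition required_diag :: "nat \<Rightarrow> real" where
  "required_diag k = (\<Sum>l=1..Nq. \<omega> l * (exp (- \<theta> l * tstar \<sigma> t k) * D_exp t (\<theta> l) (k - 1)
     + exp (- \<theta> l * tstar \<sigma> t (Suc k)) * (D_exp t (\<theta> l) k - D_exp t (\<theta> l) (k - 1))))"

lemma required_diag_le:
  assumes "1 \<le> k"
  shows "required_diag k \<le> 2 * (c_hat K \<sigma> t k (k - 1) + \<sigma> powr (1 - \<alpha>) / ((1 - \<alpha>) * tau t k powr \<alpha>))"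
proof (cases "k = 1")
  case True
  have "required_diag 1 = (\<Sum>l=1..Nq. \<omega> l * (exp (- \<theta> l * tstar \<sigma> t 2) * D_exp t (\<theta> l) 1))"
    by (simp add: required_diag_def D_exp_def[of _ _ 0] numeral_2_eq_2)
  also have "\<dots> \<le> (\<Sum>l=1..Nq. \<omega> l * exp (- \<theta> l * (\<sigma> * tau t 2)))"
    using soe_pos by (intro sum_mono mult_left_mono first_mode_diagonal_le) (auto intro: less_imp_le)
  also have "\<dots> = K (\<sigma> * tau t 2)" by (simp add: soe_def)
  also have "\<dots> \<le> (\<sigma> * tau t 2) powr - \<alpha> + \<epsilon>" by (rule kernel_at_step_le) simp
  also have "\<dots> \<le> 2 * (\<sigma> powr (1 - \<alpha>) / ((1 - \<alpha>) * tau t 1 powr \<alpha>))"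
    using alpha sigma mesh_eps[of 1] tau_pos[of 1] tau_ratio[of 1]
    by (intro diagonal_budget) (auto simp: numeral_2_eq_2)
  finally show ?thesis using True by (simp add: c_hat_def)
next
  case False
  with assms have k: "2 \<le> k" by simp
  let ?e = "\<lambda>l k. exp (- \<theta> l * tstar \<sigma> t k)"
  have "required_diag k \<le> (\<Sum>l=1..Nq. \<omega> l * (2 * (?e l k * C_exp t (\<theta> l) (k - 1))
      + exp (- \<theta> l * (\<sigma> * tau t k)) + exp (- \<theta> l * (\<sigma> * tau t (Suc k))) / 2))"
    unfolding required_diag_def using soe_pos sigma_bounds k
    by (intro sum_mono mult_left_mono mode_diagonal_le) (auto intro: less_imp_le)
  also have "\<dots> = 2 * c_hat K \<sigma> t k (k - 1) + (K (\<sigma> * tau t k) + K (\<sigma> * tau t (Suc k)) / 2)"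
    by (simp add: c_hat_soe soe_def distrib_left sum.distrib sum_distrib_left sum_divide_distrib mult_ac)
  also have "K (\<sigma> * tau t k) + K (\<sigma> * tau t (Suc k)) / 2
     \<le> ((\<sigma> * tau t k) powr - \<alpha> + \<epsilon>) + ((\<sigma> * tau t (Suc k)) powr - \<alpha> + \<epsilon>) / 2"
    using k by (intro add_mono divide_right_mono kernel_at_step_le) auto
  also have "\<dots> \<le> 2 * (\<sigma> powr (1 - \<alpha>) / ((1 - \<alpha>) * tau t k powr \<alpha>))"
    using alpha sigma mesh_eps[of k] tau_pos[of k] tau_ratio[of k] k
    by (intro diagonal_budget) auto
  finally show ?thesis by simp
qed

lemma history_form_nonneg:
  "0 \<le> (\<Sum>k=1..n. x k * (\<Sum>j=1..k - 1. d_hat K \<sigma> t k j * x j) + required_diag k / 2 * (x k)\<^sup>2)"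
proof -
  let ?e = "\<lambda>l k. exp (- \<theta> l * tstar \<sigma> t k)"
  let ?F = "\<lambda>l k. x k * (\<Sum>j=1..k - 1. ?e l k * D_exp t (\<theta> l) j * x j)
     + (?e l k * D_exp t (\<theta> l) (k - 1)
       + ?e l (Suc k) * (D_exp t (\<theta> l) k - D_exp t (\<theta> l) (k - 1))) / 2 * (x k)\<^sup>2"
  have "0 \<le> (\<Sum>l=1..Nq. \<omega> l * (\<Sum>k=1..n. ?F l k))"
  proof (rule sum_nonneg)
    fix l assume "l \<in> {1..Nq}"
    with soe_pos have \<theta>: "0 < \<theta> l" and "0 < \<omega> l" by auto
    have "0 \<le> (\<Sum>k=1..n. ?F l k)"
    proof (rule semiseparable_form_nonneg)
      show "D_exp t (\<theta> l) k \<le> D_exp t (\<theta> l) (Suc k)" for k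
        using \<theta> by (intro D_exp_mono) simp
      show "?e l (Suc k) \<le> ?e l k" if "1 \<le> k" for k
        using tstar_less[OF that sigma_bounds] \<theta> by simp
    qed (auto simp: D_exp_def)
    with \<open>0 < \<omega> l\<close> show "0 \<le> \<omega> l * (\<Sum>k=1..n. ?F l k)" by simp
  qed
  also have "\<dots> = (\<Sum>k=1..n. \<Sum>l=1..Nq. \<omega> l * ?F l k)"
    unfolding sum_distrib_left by (rule sum.swap)
  also have "\<dots> = (\<Sum>k=1..n. x k * (\<Sum>j=1..k - 1. d_hat K \<sigma> t k j * x j) + required_diag k / 2 * (x k)\<^sup>2)"
  proof (rule sum.cong[OF refl])
    fix k
    have "(\<Sum>j=1..k - 1. d_hat K \<sigma> t k j * x j)
       = (\<Sum>j=1..k - 1. \<Sum>l=1..Nq. \<omega> l * (?e l k * D_exp t (\<theta> l) j * x j))"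
      by (intro sum.cong) (simp_all add: d_hat_soe sum_distrib_right mult.assoc)
    also have "\<dots> = (\<Sum>l=1..Nq. \<omega> l * (\<Sum>j=1..k - 1. ?e l k * D_exp t (\<theta> l) j * x j))"
      unfolding sum_distrib_left by (rule sum.swap)
    finally have h: "x k * (\<Sum>j=1..k - 1. d_hat K \<sigma> t k j * x j)
       = (\<Sum>l=1..Nq. \<omega> l * (x k * (\<Sum>j=1..k - 1. ?e l k * D_exp t (\<theta> l) j * x j)))"
      by (simp only: sum_distrib_left mult.left_commute)
    have d: "required_diag k / 2 * (x k)\<^sup>2 = (\<Sum>l=1..Nq. \<omega> l * ((?e l k * D_exp t (\<theta> l) (k - 1)
       + ?e l (Suc k) * (D_exp t (\<theta> l) k - D_exp t (\<theta> l) (k - 1))) / 2 * (x k)\<^sup>2))"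
      unfolding required_diag_def sum_divide_distrib sum_distrib_right by (intro sum.cong) auto
    show "(\<Sum>l=1..Nq. \<omega> l * ?F l k)
      = x k * (\<Sum>j=1..k - 1. d_hat K \<sigma> t k j * x j) + required_diag k / 2 * (x k)\<^sup>2"
      unfolding h d by (simp only: distrib_left sum.distrib)
  qed
  finally show ?thesis .
qed

text \<open>The operator has \<open>c_hat\<close> and the local term on its diagonal; by \<open>required_diag_le\<close> these dominate the diagonal
for which the history form is nonnegative.\<close>

lemma fast_form_nonneg:
  "0 \<le> (\<Sum>k=1..n. x k * (1 / Gamma (1 - \<alpha>) *
       (c_hat K \<sigma> t k (k - 1) * x k + (\<Sum>j=1..k - 1. d_hat K \<sigma> t k j * x j))
     + \<sigma> powr (1 - \<alpha>) / (Gamma (2 - \<alpha>) * tau t k powr \<alpha>) * x k))"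
proof -
  have G: "0 < Gamma (1 - \<alpha>)" using alpha by (intro Gamma_real_pos) simp
  have G2: "Gamma (2 - \<alpha>) = (1 - \<alpha>) * Gamma (1 - \<alpha>)"
  proof -
    have "1 - \<alpha> \<notin> \<int>\<^sub>\<le>\<^sub>0" using alpha by (auto elim!: nonpos_Ints_cases)
    from Gamma_plus1[OF this] show ?thesis by simp
  qed
  let ?h = "\<lambda>k. (\<Sum>j=1..k - 1. d_hat K \<sigma> t k j * x j)"
  let ?s = "\<lambda>k. c_hat K \<sigma> t k (k - 1) + \<sigma> powr (1 - \<alpha>) / ((1 - \<alpha>) * tau t k powr \<alpha>)"
  have "0 \<le> 1 / Gamma (1 - \<alpha>) * (\<Sum>k=1..n. x k * ?h k + required_diag k / 2 * (x k)\<^sup>2)"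
    using G history_form_nonneg by simp
  also have "\<dots> \<le> 1 / Gamma (1 - \<alpha>) * (\<Sum>k=1..n. x k * ?h k + ?s k * (x k)\<^sup>2)"
    using G required_diag_le by (intro mult_left_mono sum_mono add_left_mono mult_right_mono) (auto simp: field_simps)
  also have "\<dots> = (\<Sum>k=1..n. x k * (1 / Gamma (1 - \<alpha>) * (c_hat K \<sigma> t k (k - 1) * x k + ?h k)
     + \<sigma> powr (1 - \<alpha>) / (Gamma (2 - \<alpha>) * tau t k powr \<alpha>) * x k))"
  proof -
    have "1 / Gamma (1 - \<alpha>) * (y * h + (c + s / ((1 - \<alpha>) * q)) * y\<^sup>2)
      = y * (1 / Gamma (1 - \<alpha>) * (c * y + h) + s / (Gamma (2 - \<alpha>) * q) * y)" for y h c s q :: real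
      using G unfolding G2 by (simp add: algebra_simps add_divide_distrib power2_eq_square)
    then show ?thesis unfolding sum_distrib_left[of "1 / Gamma (1 - \<alpha>)"] by (intro sum.cong refl)
  qed
  finally show ?thesis .
qed

end

section \<open>The space of square integrable functions\<close>

lemma L2_D:
  assumes "v \<in> L2 \<Omega>"
  shows "v \<in> borel_measurable (lebesgue_on \<Omega>)" "integrable (lebesgue_on \<Omega>) (\<lambda>x. (norm (v x))\<^sup>2)"
  using assms by (auto simp: L2_def)

lemma L2_inner_integrable:
  assumes v: "v \<in> L2 \<Omega>" and w: "w \<in> L2 \<Omega>"
  shows "integrable (lebesgue_on \<Omega>) (\<lambda>x. v x \<bullet> w x)"
proof (rule Bochner_Integration.integrable_bound)
  show "integrable (lebesgue_on \<Omega>) (\<lambda>x. (norm (v x))\<^sup>2 + (norm (w x))\<^sup>2)"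
    using L2_D[OF v] L2_D[OF w] by (intro Bochner_Integration.integrable_add)
  show "(\<lambda>x. v x \<bullet> w x) \<in> borel_measurable (lebesgue_on \<Omega>)"
    using L2_D[OF v] L2_D[OF w] by (intro borel_measurable_inner)
  have "norm (v x \<bullet> w x) \<le> (norm (v x))\<^sup>2 + (norm (w x))\<^sup>2" for x
  proof -
    have "norm (v x \<bullet> w x) \<le> norm (v x) * norm (w x)" using Cauchy_Schwarz_ineq2 by simp
    also have "\<dots> \<le> (norm (v x))\<^sup>2 + (norm (w x))\<^sup>2"
      using sum_squares_bound[of "norm (v x)" "norm (w x)"]
        mult_nonneg_nonneg[OF norm_ge_zero norm_ge_zero, of "v x" "w x"] unfolding mult.assoc by linarith
    finally show ?thesis .
  qed
  then show "AE x in lebesgue_on \<Omega>. norm (v x \<bullet> w x) \<le> norm ((norm (v x))\<^sup>2 + (norm (w x))\<^sup>2)"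
    by (intro AE_I2) (simp add: add_nonneg_nonneg)
qed

lemma L2_scaleR: "v \<in> L2 \<Omega> \<Longrightarrow> (\<lambda>x. c *\<^sub>R v x) \<in> L2 \<Omega>"
  by (auto simp: L2_def power_mult_distrib)

lemma L2_add:
  assumes v: "v \<in> L2 \<Omega>" and w: "w \<in> L2 \<Omega>"
  shows "(\<lambda>x. v x + w x) \<in> L2 \<Omega>"
proof -
  have "integrable (lebesgue_on \<Omega>) (\<lambda>x. (norm (v x))\<^sup>2 + (norm (w x))\<^sup>2 + 2 * (v x \<bullet> w x))"
    using L2_D[OF v] L2_D[OF w] L2_inner_integrable[OF v w]
    by (intro Bochner_Integration.integrable_add integrable_mult_right)
  moreover have "(norm (v x))\<^sup>2 + (norm (w x))\<^sup>2 + 2 * (v x \<bullet> w x) = (norm (v x + w x))\<^sup>2" for x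
    by (simp add: power2_norm_eq_inner inner_add inner_commute)
  ultimately show ?thesis using L2_D[OF v] L2_D[OF w] by (simp add: L2_def)
qed

lemma L2_diff:
  assumes "v \<in> L2 \<Omega>" and "w \<in> L2 \<Omega>"
  shows "(\<lambda>x. v x - w x) \<in> L2 \<Omega>"
  using L2_add[OF assms(1) L2_scaleR[OF assms(2), of "-1"]] by simp

lemma L2_zero: "(\<lambda>x. 0) \<in> L2 \<Omega>"
  by (simp add: L2_def)

lemma L2_sum: "(\<And>i. i \<in> I \<Longrightarrow> v i \<in> L2 \<Omega>) \<Longrightarrow> (\<lambda>x. \<Sum>i\<in>I. v i x) \<in> L2 \<Omega>"
  by (induction I rule: infinite_finite_induct) (auto intro: L2_zero L2_add)

lemma L2_inner_commute: "L2_inner \<Omega> v w = L2_inner \<Omega> w v"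
  by (simp add: L2_inner_def inner_commute)

lemma L2_inner_add_left:
  "\<lbrakk>u \<in> L2 \<Omega>; v \<in> L2 \<Omega>; w \<in> L2 \<Omega>\<rbrakk> \<Longrightarrow> L2_inner \<Omega> (\<lambda>x. u x + v x) w = L2_inner \<Omega> u w + L2_inner \<Omega> v w"
  by (simp add: L2_inner_def inner_add_left L2_inner_integrable)

lemma L2_inner_diff_left:
  "\<lbrakk>u \<in> L2 \<Omega>; v \<in> L2 \<Omega>; w \<in> L2 \<Omega>\<rbrakk> \<Longrightarrow> L2_inner \<Omega> (\<lambda>x. u x - v x) w = L2_inner \<Omega> u w - L2_inner \<Omega> v w"
  by (simp add: L2_inner_def inner_diff_left L2_inner_integrable)

lemma L2_inner_diff_right:
  "\<lbrakk>u \<in> L2 \<Omega>; v \<in> L2 \<Omega>; w \<in> L2 \<Omega>\<rbrakk> \<Longrightarrow> L2_inner \<Omega> w (\<lambda>x. u x - v x) = L2_inner \<Omega> w u - L2_inner \<Omega> w v"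
  by (simp add: L2_inner_def inner_diff_right L2_inner_integrable)

lemma L2_inner_scaleR_left: "L2_inner \<Omega> (\<lambda>x. c *\<^sub>R v x) w = c * L2_inner \<Omega> v w"
  by (simp add: L2_inner_def)

lemma L2_inner_self_nonneg: "0 \<le> L2_inner \<Omega> v v"
  by (simp add: L2_inner_def)

lemma L2_norm_nonneg: "0 \<le> L2_norm \<Omega> v"
  by (simp add: L2_norm_def L2_inner_self_nonneg)

lemma L2_norm_sq: "(L2_norm \<Omega> v)\<^sup>2 = L2_inner \<Omega> v v"
  by (simp add: L2_norm_def L2_inner_self_nonneg)

lemma L2_inner_AE_cong:
  assumes "v \<in> L2 \<Omega>" "v' \<in> L2 \<Omega>" "w \<in> L2 \<Omega>" and "AE x in lebesgue_on \<Omega>. v x = v' x"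
  shows "L2_inner \<Omega> v w = L2_inner \<Omega> v' w"
  unfolding L2_inner_def using assms
  by (intro integral_cong_AE borel_measurable_integrable L2_inner_integrable) auto

lemma L2_norm_AE_cong:
  assumes "v \<in> L2 \<Omega>" "v' \<in> L2 \<Omega>" and "AE x in lebesgue_on \<Omega>. v x = v' x"
  shows "L2_norm \<Omega> v = L2_norm \<Omega> v'"
  using L2_inner_AE_cong[OF assms(1,2,1,3)] L2_inner_AE_cong[OF assms(1,2,2,3)]
  by (simp add: L2_norm_def L2_inner_commute)

text \<open>The usual discriminant argument: \<open>v + r w\<close> has nonnegative square integral for every real \<open>r\<close>. If \<open>w\<close> has norm
zero, a large multiple \<open>r\<close> forces the inner product to vanish.\<close>

lemma L2_Cauchy_Schwarz:
  assumes v: "v \<in> L2 \<Omega>" and w: "w \<in> L2 \<Omega>"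
  shows "\<bar>L2_inner \<Omega> v w\<bar> \<le> L2_norm \<Omega> v * L2_norm \<Omega> w"
proof -
  let ?a = "L2_inner \<Omega> v v" and ?b = "L2_inner \<Omega> w w" and ?c = "L2_inner \<Omega> v w"
  have expand: "0 \<le> ?a + 2 * r * ?c + r\<^sup>2 * ?b" for r
  proof -
    have "0 \<le> L2_inner \<Omega> (\<lambda>x. v x + r *\<^sub>R w x) (\<lambda>x. v x + r *\<^sub>R w x)" by (rule L2_inner_self_nonneg)
    also have "\<dots> = (LINT x|lebesgue_on \<Omega>. v x \<bullet> v x + 2 * r * (v x \<bullet> w x) + r\<^sup>2 * (w x \<bullet> w x))"
      unfolding L2_inner_def
      by (rule Bochner_Integration.integral_cong)
        (auto simp: inner_add_left inner_add_right inner_commute[of "w _" "v _"] power2_eq_square algebra_simps)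
    also have "\<dots> = ?a + 2 * r * ?c + r\<^sup>2 * ?b"
      using L2_inner_integrable[OF v v] L2_inner_integrable[OF v w] L2_inner_integrable[OF w w]
      by (simp add: L2_inner_def)
    finally show ?thesis .
  qed
  have "?c\<^sup>2 \<le> ?a * ?b"
  proof (cases "?b = 0")
    case True
    have "?c = 0"
    proof (rule ccontr)
      assume "?c \<noteq> 0"
      then have "2 * (- (?a + 1) / (2 * ?c)) * ?c = - (?a + 1)" by simp
      with expand[of "- (?a + 1) / (2 * ?c)"] True show False by simp
    qed
    then show ?thesis using True by simp
  next
    case False
    then have b: "0 < ?b" using L2_inner_self_nonneg[of \<Omega> w] by simp
    have "0 \<le> (?a + 2 * (- ?c / ?b) * ?c + (- ?c / ?b)\<^sup>2 * ?b) * ?b"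
      using expand[of "- ?c / ?b"] b by simp
    also have "\<dots> = ?a * ?b - ?c\<^sup>2"
      using b by (simp add: field_simps power2_eq_square)
    finally show ?thesis by simp
  qed
  then have "\<bar>?c\<bar> \<le> sqrt (?a * ?b)" using real_le_rsqrt by simp
  then show ?thesis by (simp add: L2_norm_def real_sqrt_mult)
qed

lemma L2_norm_triangle:
  assumes v: "v \<in> L2 \<Omega>" and w: "w \<in> L2 \<Omega>"
  shows "L2_norm \<Omega> (\<lambda>x. v x - w x) \<le> L2_norm \<Omega> v + L2_norm \<Omega> w"
proof (rule power2_le_imp_le)
  have "(L2_norm \<Omega> (\<lambda>x. v x - w x))\<^sup>2 = L2_inner \<Omega> v v - 2 * L2_inner \<Omega> v w + L2_inner \<Omega> w w"
    using v w by (simp add: L2_norm_sq L2_inner_diff_left L2_inner_diff_right L2_diff L2_inner_commute[of \<Omega> w v])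
  also have "\<dots> \<le> (L2_norm \<Omega> v + L2_norm \<Omega> w)\<^sup>2"
    using L2_Cauchy_Schwarz[OF v w] by (simp add: power2_sum L2_norm_sq)
  finally show "(L2_norm \<Omega> (\<lambda>x. v x - w x))\<^sup>2 \<le> (L2_norm \<Omega> v + L2_norm \<Omega> w)\<^sup>2" .
qed (simp add: L2_norm_nonneg)

section \<open>Smooth bumps in boxes\<close>

text \<open>A class of one-dimensional functions that contains the bump \<open>exp (- e / ((x - a) (b - x)))\<close> and is closed under
differentiation: only the polynomial and the exponent \<open>n\<close> change.\<close>

definition bumps :: "real \<Rightarrow> real \<Rightarrow> real \<Rightarrow> (real \<Rightarrow> real) set" where
  "bumps a b e = {f. \<exists>p n. real_polynomial_function p \<and>
     (\<forall>x. f x = (if a < x \<and> x < b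
        then p x / ((x - a) * (b - x)) ^ n * exp (- e / ((x - a) * (b - x))) else 0))}"

lemma exp_ge_power_fact:
  fixes y :: real
  assumes "0 \<le> y" shows "y ^ n / fact n \<le> exp y"
proof -
  have s: "(\<lambda>n. y ^ n /\<^sub>R fact n) sums exp y" by (rule exp_converges)
  have "(\<Sum>i\<in>{n}. y ^ i /\<^sub>R fact i) \<le> (\<Sum>i. y ^ i /\<^sub>R fact i)"
    using assms s by (intro sum_le_suminf) (auto simp: sums_iff)
  then show ?thesis using s by (simp add: sums_iff divide_inverse mult.commute)
qed

lemma DERIV_zero_of_quadratic_bound:
  fixes f :: "real \<Rightarrow> real"
  assumes "\<And>x. \<bar>f x\<bar> \<le> C * (x - c)\<^sup>2"
  shows "(f has_real_derivative 0) (at c)"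
proof -
  have fc: "f c = 0" using assms[of c] by simp
  have "((\<lambda>h. f (c + h) / h) \<longlongrightarrow> 0) (at 0)"
  proof (rule Lim_null_comparison)
    show "\<forall>\<^sub>F h in at 0. norm (f (c + h) / h) \<le> C * \<bar>h\<bar>"
    proof (rule always_eventually, rule allI)
      fix h
      show "norm (f (c + h) / h) \<le> C * \<bar>h\<bar>"
        using assms[of "c + h"] by (cases "h = 0") (auto simp: divide_simps power2_eq_square abs_mult)
    qed
    show "((\<lambda>h. C * \<bar>h\<bar>) \<longlongrightarrow> 0) (at (0::real))"
      by (auto intro!: tendsto_eq_intros)
  qed
  then show ?thesis by (simp add: DERIV_def fc)
qed

text \<open>The exponential beats every power of \<open>w = 1 / ((x - a) (b - x))\<close>: from \<open>(e w) ^ (n + 2) / (n + 2)! \<le> exp (e w)\<close>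
the function is of the order of \<open>w\<close> to the power \<open>-2\<close>, hence flat at both end points.\<close>

lemma bumps_quadratic:
  assumes f: "f \<in> bumps a b e" and "0 < e" and c: "c = a \<or> c = b"
  shows "\<exists>C. \<forall>x. \<bar>f x\<bar> \<le> C * (x - c)\<^sup>2"
proof -
  obtain p n where p: "real_polynomial_function p"
    and f: "\<And>x. f x = (if a < x \<and> x < b
        then p x / ((x - a) * (b - x)) ^ n * exp (- e / ((x - a) * (b - x))) else 0)"
    using f by (auto simp: bumps_def)
  have "compact (p ` {a..b})"
    using p by (intro compact_continuous_image continuous_on_polymonial_function)
      (auto simp: real_polynomial_function_eq)
  then obtain B where B: "\<And>x. x \<in> {a..b} \<Longrightarrow> \<bar>p x\<bar> \<le> B" "0 < B"
    by (auto simp: bounded_pos dest!: compact_imp_bounded) (meson atLeastAtMost_iff)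
  let ?C = "B * (fact (n + 2) / e ^ (n + 2)) * (b - a)\<^sup>2"
  have "\<bar>f x\<bar> \<le> ?C * (x - c)\<^sup>2" for x
  proof (cases "a < x \<and> x < b")
    case True
    define m where "m = (x - a) * (b - x)"
    have m: "0 < m" using True by (simp add: m_def)
    define A :: real where "A = fact (n + 2)"
    have "0 < A" by (simp add: A_def del: fact_Suc)
    have "(e / m) ^ (n + 2) / A \<le> exp (e / m)"
      unfolding A_def using m \<open>0 < e\<close> by (intro exp_ge_power_fact) auto
    then have "1 / m ^ n * exp (- e / m) \<le> A / e ^ (n + 2) * m\<^sup>2"
      using m \<open>0 < e\<close> \<open>0 < A\<close>
      by (simp add: exp_minus power_divide power_add field_simps power2_eq_square)
    then have "1 / m ^ n * exp (- e / m) \<le> fact (n + 2) / e ^ (n + 2) * m\<^sup>2"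
      by (simp only: A_def)
    then have "\<bar>p x\<bar> * (1 / m ^ n * exp (- e / m)) \<le> B * (fact (n + 2) / e ^ (n + 2) * m\<^sup>2)"
      by (rule mult_mono[rotated]) (use B True m in auto)
    also have "m\<^sup>2 \<le> ((b - a) * \<bar>x - c\<bar>)\<^sup>2"
    proof (rule power_mono)
      show "m \<le> (b - a) * \<bar>x - c\<bar>"
        using c
      proof
        assume "c = a"
        have "(x - a) * (b - x) \<le> (x - a) * (b - a)" using True by (intro mult_left_mono) auto
        then show ?thesis using True \<open>c = a\<close> by (simp add: m_def mult.commute)
      next
        assume "c = b"
        have "(x - a) * (b - x) \<le> (b - a) * (b - x)" using True by (intro mult_right_mono) auto
        then show ?thesis using True \<open>c = b\<close> by (simp add: m_def)
      qed
    qed (use m in simp)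
    then have "B * (fact (n + 2) / e ^ (n + 2) * m\<^sup>2) \<le> B * (fact (n + 2) / e ^ (n + 2) * ((b - a) * \<bar>x - c\<bar>)\<^sup>2)"
      using B \<open>0 < e\<close> by (intro mult_left_mono) auto
    also have "\<dots> = ?C * (x - c)\<^sup>2" by (simp add: power_mult_distrib)
    also have "\<bar>p x\<bar> * (1 / m ^ n * exp (- e / m)) = \<bar>f x\<bar>"
      using True m by (simp add: f m_def[symmetric] abs_mult)
    finally show ?thesis .
  next
    case False
    then have "f x = 0" by (simp only: f if_False)
    moreover have "0 \<le> ?C * (x - c)\<^sup>2"
      using B \<open>0 < e\<close> by (intro mult_nonneg_nonneg divide_nonneg_nonneg) auto
    ultimately show ?thesis by simp
  qed
  then show ?thesis by blast
qed

lemma bumps_derivative: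
  assumes f: "f \<in> bumps a b e" and "0 < e"
  shows "\<exists>f'\<in>bumps a b e. \<forall>x. (f has_real_derivative f' x) (at x)"
proof -
  obtain p n where p: "real_polynomial_function p"
    and f_eq: "\<And>x. f x = (if a < x \<and> x < b
        then p x / ((x - a) * (b - x)) ^ n * exp (- e / ((x - a) * (b - x))) else 0)"
    using f by (auto simp: bumps_def)
  obtain p' where p': "real_polynomial_function p'" "\<And>x. (p has_real_derivative p' x) (at x)"
    using has_real_derivative_polynomial_function[OF p] by blast
  define q where "q x = p' x * ((x - a) * (b - x)) ^ 2
     + p x * (a + b - 2 * x) * (e - of_nat n * ((x - a) * (b - x)))" for x
  define f' where "f' x = (if a < x \<and> x < b
        then q x / ((x - a) * (b - x)) ^ (n + 2) * exp (- e / ((x - a) * (b - x))) else 0)" for x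
  have "real_polynomial_function q"
    unfolding q_def[abs_def]
    by (intro real_polynomial_function.intros p p' real_polynomial_function_power
        real_polynomial_function_diff bounded_linear_ident)
  then have "f' \<in> bumps a b e" 
    unfolding bumps_def f'_def by (intro CollectI exI[of _ q] exI[of _ "n + 2"] conjI allI refl)
  moreover have "(f has_real_derivative f' x) (at x)" for x
  proof -
    consider "a < x \<and> x < b" | "x = a \<or> x = b" | "x < a \<or> b < x" by linarith
    then show ?thesis
    proof cases
      case 1
      define m where "m x = (x - a) * (b - x)" for x
      have m: "0 < m x" using 1 by (simp add: m_def)
      have dm: "(m has_real_derivative (a + b - 2 * x)) (at x)"
        unfolding m_def[abs_def] by (auto intro!: derivative_eq_intros)
      have "((\<lambda>x. p x * inverse (m x) ^ n * exp (- e * inverse (m x))) has_real_derivative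
          p' x * inverse (m x) ^ n * exp (- e * inverse (m x))
          + p x * (of_nat n * inverse (m x) ^ (n - 1) * (- (inverse (m x) * (a + b - 2 * x) * inverse (m x)))) * exp (- e * inverse (m x))
          + p x * inverse (m x) ^ n * (exp (- e * inverse (m x)) * (- e * - (inverse (m x) * (a + b - 2 * x) * inverse (m x))))) (at x)"
        using m by (auto intro!: derivative_eq_intros p' dm simp: algebra_simps)
      also have "p' x * inverse (m x) ^ n * exp (- e * inverse (m x))
          + p x * (of_nat n * inverse (m x) ^ (n - 1) * (- (inverse (m x) * (a + b - 2 * x) * inverse (m x)))) * exp (- e * inverse (m x))
          + p x * inverse (m x) ^ n * (exp (- e * inverse (m x)) * (- e * - (inverse (m x) * (a + b - 2 * x) * inverse (m x))))
         = (p' x * (m x)\<^sup>2 + p x * (a + b - 2 * x) * (e - of_nat n * m x)) * inverse (m x) ^ (n + 2)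
           * exp (- e * inverse (m x))"
        using m by (cases n) (auto simp: field_simps power2_eq_square)
      finally have "((\<lambda>x. p x / m x ^ n * exp (- e / m x)) has_real_derivative f' x) (at x)"
        using 1 by (simp add: f'_def q_def m_def[symmetric] divide_inverse power_inverse)
      then show ?thesis
        by (rule has_field_derivative_transform_within_open[where S = "{a<..<b}"])
          (use 1 in \<open>auto simp: f_eq m_def\<close>)
    next
      case 2
      then obtain C where "\<And>x'. \<bar>f x'\<bar> \<le> C * (x' - x)\<^sup>2"
        using bumps_quadratic[OF f \<open>0 < e\<close>, of x] by blast
      then have "(f has_real_derivative 0) (at x)" by (rule DERIV_zero_of_quadratic_bound)
      then show ?thesis using 2 by (auto simp: f'_def)
    next
      case 3
      have "((\<lambda>x. 0) has_real_derivative 0) (at x)" by simp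
      then have "(f has_real_derivative 0) (at x)"
        by (rule has_field_derivative_transform_within_open[where S = "- {a..b}"])
          (use 3 in \<open>auto simp: f_eq\<close>)
      then show ?thesis using 3 by (auto simp: f'_def)
    qed
  qed
  ultimately show ?thesis by blast
qed

text \<open>The partial derivative of a product of functions of the single coordinates differentiates one factor, so it is a product
of the same kind. This is why iterated differentiability of products needs no Leibniz rule.\<close>

definition product_fun :: "('a::euclidean_space \<Rightarrow> real \<Rightarrow> real) \<Rightarrow> 'a \<Rightarrow> real" where
  "product_fun F x = (\<Prod>i\<in>Basis. F i (x \<bullet> i))"

lemma product_fun_has_derivative:
  fixes F F' :: "'a::euclidean_space \<Rightarrow> real \<Rightarrow> real"
  assumes "\<And>i y. i \<in> Basis \<Longrightarrow> (F i has_real_derivative F' i y) (at y)"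
  shows "(product_fun F has_derivative
     (\<lambda>h. \<Sum>i\<in>Basis. F' i (x \<bullet> i) * (h \<bullet> i) * (\<Prod>j\<in>Basis - {i}. F j (x \<bullet> j)))) (at x)"
  unfolding product_fun_def[abs_def]
proof (rule has_derivative_prod)
  fix i :: 'a assume i: "i \<in> Basis"
  have "((\<lambda>x. x \<bullet> i) has_derivative (\<lambda>h. h \<bullet> i)) (at x)"
    by (auto intro!: derivative_eq_intros)
  from has_derivative_compose[OF this assms[OF i, unfolded has_field_derivative_def]]
  show "((\<lambda>x. F i (x \<bullet> i)) has_derivative (\<lambda>h. F' i (x \<bullet> i) * (h \<bullet> i))) (at x)"
    by simp
qed

lemma Ck_product_bumps:
  fixes F :: "'a::euclidean_space \<Rightarrow> real \<Rightarrow> real"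
  assumes "\<And>i. i \<in> Basis \<Longrightarrow> F i \<in> bumps (a \<bullet> i) (b \<bullet> i) e" and "0 < e"
  shows "Ck k (product_fun F)"
  using assms(1)
proof (induction k arbitrary: F)
  case (0 F)
  have "\<exists>F'. \<forall>i\<in>Basis. F' i \<in> bumps (a \<bullet> i) (b \<bullet> i) e \<and> (\<forall>y. (F i has_real_derivative F' i y) (at y))"
    using bumps_derivative[OF 0 \<open>0 < e\<close>] by (intro bchoice) blast
  then obtain F' where "\<And>i y. i \<in> Basis \<Longrightarrow> (F i has_real_derivative F' i y) (at y)" by blast
  from product_fun_has_derivative[OF this] show ?case
    by (auto intro!: continuous_at_imp_continuous_on has_derivative_continuous)
next
  case (Suc k F)
  have "\<exists>F'. \<forall>i\<in>Basis. F' i \<in> bumps (a \<bullet> i) (b \<bullet> i) e \<and> (\<forall>y. (F i has_real_derivative F' i y) (at y))"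
    using bumps_derivative[OF Suc.prems \<open>0 < e\<close>] by (intro bchoice) blast
  then obtain F' where F': "\<And>i. i \<in> Basis \<Longrightarrow> F' i \<in> bumps (a \<bullet> i) (b \<bullet> i) e"
    and d: "\<And>i y. i \<in> Basis \<Longrightarrow> (F i has_real_derivative F' i y) (at y)" by blast
  have D: "(product_fun F has_derivative
     (\<lambda>h. \<Sum>i\<in>Basis. F' i (x \<bullet> i) * (h \<bullet> i) * (\<Prod>j\<in>Basis - {i}. F j (x \<bullet> j)))) (at x)" for x
    by (rule product_fun_has_derivative) (rule d)
  have "frechet_derivative (product_fun F) (at x) c = product_fun (F(c := F' c)) x"
    if c: "c \<in> Basis" for c x :: 'a
  proof -
    have "frechet_derivative (product_fun F) (at x) c
       = (\<Sum>i\<in>Basis. F' i (x \<bullet> i) * (c \<bullet> i) * (\<Prod>j\<in>Basis - {i}. F j (x \<bullet> j)))"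
      by (simp flip: frechet_derivative_at[OF D])
    also have "\<dots> = (\<Sum>i\<in>Basis. if i = c then F' i (x \<bullet> i) * (\<Prod>j\<in>Basis - {i}. F j (x \<bullet> j)) else 0)"
      using c by (intro sum.cong) (auto simp: inner_Basis)
    also have "\<dots> = F' c (x \<bullet> c) * (\<Prod>j\<in>Basis - {c}. F j (x \<bullet> j))"
      using c by simp
    also have "\<dots> = product_fun (F(c := F' c)) x"
      using c by (simp add: product_fun_def prod.remove[OF finite_Basis c])
    finally show ?thesis .
  qed
  moreover have "Ck k (product_fun (F(c := F' c)))" if "c \<in> Basis" for c
    using Suc.prems F' that by (intro Suc.IH) auto
  moreover have "product_fun F differentiable (at x)" for x
    using D by (auto simp: differentiable_def)
  ultimately show ?case by auto
qed

definition box_bump :: "'a::euclidean_space \<Rightarrow> 'a \<Rightarrow> real \<Rightarrow> 'a \<Rightarrow> real" where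
  "box_bump a b e = product_fun (\<lambda>i x. if a \<bullet> i < x \<and> x < b \<bullet> i
     then exp (- e / ((x - a \<bullet> i) * (b \<bullet> i - x))) else 0)"

lemma box_bump_Ck: "0 < e \<Longrightarrow> Ck k (box_bump a b e)"
  unfolding box_bump_def
  by (rule Ck_product_bumps[where a = a and b = b and e = e])
    (auto simp: bumps_def intro!: exI[of _ "\<lambda>x. 1"] exI[of _ 0] real_polynomial_function.intros)

lemma box_bump_nonzero_iff: "box_bump a b e x \<noteq> 0 \<longleftrightarrow> x \<in> box a b"
  by (auto simp: box_bump_def product_fun_def mem_box)

lemma box_bump_bounds: "0 < e \<Longrightarrow> 0 \<le> box_bump a b e x \<and> box_bump a b e x \<le> 1"
  unfolding box_bump_def product_fun_def
  by (auto intro!: prod_nonneg prod_le_1 divide_nonneg_nonneg)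

lemma box_bump_test_function:
  assumes "0 < e" "cbox a b \<subseteq> \<Omega>"
  shows "box_bump a b e \<in> test_functions \<Omega>"
proof -
  have "{x. box_bump a b e x \<noteq> 0} = box a b" by (auto simp: box_bump_nonzero_iff)
  moreover have "closure (box a b) \<subseteq> cbox a b"
    by (intro closure_minimal box_subset_cbox closed_cbox)
  moreover from this have "compact (closure (box a b))"
    by (simp add: bounded_subset[OF bounded_cbox] compact_eq_bounded_closed)
  ultimately show ?thesis
    using assms box_bump_Ck by (auto simp: test_functions_def)
qed

text \<open>As \<open>e\<close> tends to zero, the bumps increase to the indicator function of the open box.\<close>

lemma box_bump_tendsto:
  "(\<lambda>n. box_bump a b (1 / Suc n) x) \<longlonglongrightarrow> indicator (box a b) x"
proof (cases "x \<in> box a b")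
  case True
  have "(\<lambda>n. \<Prod>i\<in>Basis. exp (- (1 / real (Suc n)) / ((x \<bullet> i - a \<bullet> i) * (b \<bullet> i - x \<bullet> i)))) \<longlonglongrightarrow> (\<Prod>i\<in>(Basis :: 'a set). exp 0)"
  proof (intro tendsto_prod tendsto_exp)
    fix i
    have "(\<lambda>n. (- (1 / real (Suc n))) / ((x \<bullet> i - a \<bullet> i) * (b \<bullet> i - x \<bullet> i))) \<longlonglongrightarrow> (- 0) / ((x \<bullet> i - a \<bullet> i) * (b \<bullet> i - x \<bullet> i))"
      unfolding divide_inverse[of _ "_ * _"]
      by (intro tendsto_mult_right tendsto_minus LIMSEQ_Suc[OF lim_1_over_n])
    then show "(\<lambda>n. - (1 / real (Suc n)) / ((x \<bullet> i - a \<bullet> i) * (b \<bullet> i - x \<bullet> i))) \<longlonglongrightarrow> 0" by simp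
  qed
  moreover have "box_bump a b e x = (\<Prod>i\<in>Basis. exp (- e / ((x \<bullet> i - a \<bullet> i) * (b \<bullet> i - x \<bullet> i))))" for e
    using True by (auto simp: box_bump_def product_fun_def mem_box intro!: prod.cong)
  ultimately show ?thesis using True by simp
next
  case False
  then have "box_bump a b e x = 0" for e using box_bump_nonzero_iff by blast
  then show ?thesis using False by simp
qed

section \<open>The fundamental lemma of the calculus of variations\<close>

lemma L2_integrable:
  fixes h :: "'a::euclidean_space \<Rightarrow> real"
  assumes "h \<in> L2 \<Omega>" "\<Omega> \<in> lmeasurable"
  shows "integrable (lebesgue_on \<Omega>) h"
proof -
  have "(\<lambda>x. 1::real) \<in> L2 \<Omega>"
    using finite_measure.integrable_const[OF finite_measure_lebesgue_on[OF assms(2)], of "1::real"]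
    by (simp add: L2_def)
  from L2_inner_integrable[OF assms(1) this] show ?thesis by simp
qed

lemma integral_box_eq_0:
  fixes h :: "'a::euclidean_space \<Rightarrow> real"
  assumes h: "integrable (lebesgue_on \<Omega>) h"
    and test: "\<And>\<phi>. \<phi> \<in> test_functions \<Omega> \<Longrightarrow> (LINT x|lebesgue_on \<Omega>. h x * \<phi> x) = 0"
    and "cbox a b \<subseteq> \<Omega>" and \<Omega>: "\<Omega> \<in> sets lebesgue"
  shows "(LINT x|lebesgue_on \<Omega>. h x * indicator (box a b) x) = 0"
proof -
  let ?M = "lebesgue_on \<Omega>"
  let ?s = "\<lambda>n. box_bump a b (1 / Suc n)"
  have test_s: "?s n \<in> test_functions \<Omega>" for n
    using assms by (intro box_bump_test_function) auto
  have "(\<lambda>n. LINT x|?M. h x * ?s n x) \<longlonglongrightarrow> (LINT x|?M. h x * indicator (box a b) x)"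
  proof (rule integral_dominated_convergence)
    have "Ck 0 (?s n)" for n by (intro box_bump_Ck) simp
    then have "?s n \<in> borel_measurable ?M" for n
      using \<Omega> by (intro continuous_imp_measurable_on_sets_lebesgue) (auto intro: continuous_on_subset)
    then show "(\<lambda>x. h x * ?s n x) \<in> borel_measurable ?M" for n
      using h by (intro borel_measurable_times) auto
    have "indicator (box a b) \<in> borel_measurable ?M"
      by (rule measurable_restrict_space1) (rule borel_measurable_indicator, simp)
    then show "(\<lambda>x. h x * indicator (box a b) x) \<in> borel_measurable ?M"
      using h by (intro borel_measurable_times) auto
    show "integrable ?M (\<lambda>x. norm (h x))" using h by simp
    show "AE x in ?M. (\<lambda>n. h x * ?s n x) \<longlonglongrightarrow> h x * indicator (box a b) x"
      by (intro AE_I2 tendsto_mult_left box_bump_tendsto)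
    show "AE x in ?M. norm (h x * ?s n x) \<le> norm (h x)" for n
    proof (rule AE_I2)
      fix x
      have "0 \<le> ?s n x" "?s n x \<le> 1" using box_bump_bounds[of "1 / Suc n" a b x] by auto
      then show "norm (h x * ?s n x) \<le> norm (h x)"
        by (simp add: abs_mult mult_left_le)
    qed
  qed
  moreover have "(\<lambda>n. LINT x|?M. h x * ?s n x) = (\<lambda>n. 0)" using test[OF test_s] by simp
  ultimately show ?thesis by (simp add: LIMSEQ_const_iff)
qed

text \<open>Boxes are stable under intersection and generate the Borel sets, so all integrals over Borel sets vanish.\<close>

lemma AE_eq_0_of_box_integrals:
  fixes g :: "'a::euclidean_space \<Rightarrow> real"
  assumes g: "integrable lborel g"
    and box: "\<And>a b. (LINT x|lborel. indicator (box a b) x * g x) = 0"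
    and total: "(LINT x|lborel. g x) = 0"
  shows "AE x in lborel. g x = 0"
proof (rule sigma_finite_measure.density_zero[OF lborel.sigma_finite_measure_axioms g])
  fix A :: "'a set" assume "A \<in> sets lborel"
  then have A: "A \<in> sigma_sets UNIV (range (\<lambda>(a, b). box a b))"
    by (simp add: borel_eq_box)
  have "Int_stable (range (\<lambda>(a, b). box a b :: 'a set))"
    by (auto simp: Int_stable_def box_Int_box)
  moreover have "range (\<lambda>(a, b). box a b :: 'a set) \<subseteq> Pow UNIV" by auto
  ultimately have "set_lebesgue_integral lborel A g = 0"
    using A
  proof (induction rule: sigma_sets_induct_disjoint)
    case (basic A)
    then show ?case using box by (auto simp: set_lebesgue_integral_def)
  next
    case empty
    then show ?case by (simp add: set_lebesgue_integral_def)
  next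
    case (compl A)
    then have A: "A \<in> sets lborel" by (simp add: borel_eq_box)
    have "set_lebesgue_integral lborel (UNIV - A) g
       = (LINT x|lborel. g x - indicator A x *\<^sub>R g x)"
      unfolding set_lebesgue_integral_def
      by (rule Bochner_Integration.integral_cong) (auto simp: indicator_def)
    also have "\<dots> = 0"
      using compl.IH total g integrable_mult_indicator[OF A g] by (simp add: set_lebesgue_integral_def)
    finally show ?case .
  next
    case (union F)
    then have F: "\<And>i. F i \<in> sets lborel" by (simp add: borel_eq_box subset_eq)
    have "set_lebesgue_integral lborel (\<Union>i. F i) g = (\<Sum>i. set_lebesgue_integral lborel (F i) g)"
    proof (rule lebesgue_integral_countable_add)
      show "set_integrable lborel (\<Union>i. F i) g"
        unfolding set_integrable_def using F g by (intro integrable_mult_indicator) auto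
      show "F i \<inter> F j = {}" if "i \<noteq> j" for i j
        using union.hyps(1) that by (auto simp: disjoint_family_on_def)
    qed (rule F)
    then show ?case using union.IH by simp
  qed
  then show "set_lebesgue_integral lborel A g = 0" .
qed

text \<open>Locally, \<open>h\<close> restricted to a box whose closure lies in \<open>\<Omega>\<close> has vanishing integral over every box, as indicator functions of
boxes are limits of test functions. Countably many such boxes cover \<open>\<Omega>\<close>.\<close>

lemma fundamental_lemma_calculus_of_variations:
  fixes h :: "'a::euclidean_space \<Rightarrow> real"
  assumes h: "integrable (lebesgue_on \<Omega>) h" and "open \<Omega>"
    and test: "\<And>\<phi>. \<phi> \<in> test_functions \<Omega> \<Longrightarrow> (LINT x|lebesgue_on \<Omega>. h x * \<phi> x) = 0"
  shows "AE x in lebesgue_on \<Omega>. h x = 0"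
proof -
  have \<Omega>: "\<Omega> \<in> sets lebesgue" using \<open>open \<Omega>\<close> by simp
  have on_box: "AE x in lebesgue. x \<in> box a b \<longrightarrow> h x = 0" if ab: "cbox a b \<subseteq> \<Omega>" for a b
  proof -
    define f where "f x = h x * indicator (box a b) x" for x
    have sub: "box a b \<subseteq> \<Omega>" using ab box_subset_cbox by blast
    have f_\<Omega>: "indicator \<Omega> x *\<^sub>R f x = f x" for x
      using sub by (auto simp: f_def indicator_def)
    have box0: "(LINT x|lebesgue. indicator (box c d) x * f x) = 0" for c d
    proof -
      obtain c' d' where cd: "cbox a b \<inter> cbox c d = cbox c' d'" "box a b \<inter> box c d = box c' d'"
        by (rule that[OF Int_interval box_Int_box])
      have "(LINT x|lebesgue. indicator (box c d) x * f x)
          = (LINT x|lebesgue. indicator \<Omega> x *\<^sub>R (h x * indicator (box c' d') x))"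
        unfolding cd(2)[symmetric] using sub
        by (intro Bochner_Integration.integral_cong) (auto simp: f_def indicator_def)
      also have "\<dots> = (LINT x|lebesgue_on \<Omega>. h x * indicator (box c' d') x)"
        using \<Omega> by (subst integral_restrict_space) auto
      also have "\<dots> = 0"
        using h test ab cd \<Omega> by (intro integral_box_eq_0) auto
      finally show ?thesis .
    qed
    have f_int: "integrable lebesgue f"
    proof -
      have "integrable lebesgue (\<lambda>x. indicator \<Omega> x *\<^sub>R h x)"
        using h \<Omega> by (subst (asm) integrable_restrict_space) auto
      then have "integrable lebesgue (\<lambda>x. indicator (box a b) x *\<^sub>R (indicator \<Omega> x *\<^sub>R h x))"
        by (rule integrable_mult_indicator[rotated]) simp
      moreover have "indicator (box a b) x *\<^sub>R (indicator \<Omega> x *\<^sub>R h x) = f x" for x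
        using sub by (auto simp: f_def indicator_def)
      ultimately show ?thesis by simp
    qed
    \<comment> \<open>A Borel representative: the generator argument only sees Borel sets.\<close>
    obtain g where g: "g \<in> borel_measurable lborel" "AE x in lborel. f x = g x"
      using completion_ex_borel_measurable_real[of f lborel] f_int by auto
    have fg: "AE x in lebesgue. f x = g x" using g(2) by (rule AE_completion)
    have g_int: "integrable lborel g"
    proof -
      have "integrable lebesgue g"
        using f_int measurable_completion[OF g(1)] fg by (rule integrable_cong_AE_imp)
      then show ?thesis using integrable_completion g(1) by blast
    qed
    have g_box: "(LINT x|lborel. indicator (box c d) x * g x) = 0" for c d
    proof -
      have "(LINT x|lborel. indicator (box c d) x * g x) = (LINT x|lebesgue. indicator (box c d) x * g x)"
        using g(1) by (subst integral_completion) auto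
      also have "\<dots> = (LINT x|lebesgue. indicator (box c d) x * f x)"
        using g(1) f_int fg
        by (intro integral_cong_AE borel_measurable_times) (auto intro: measurable_completion)
      finally show ?thesis using box0 by simp
    qed
    have g_total: "(LINT x|lborel. g x) = 0"
    proof -
      have "(LINT x|lborel. g x) = (LINT x|lebesgue. g x)"
        using g(1) by (subst integral_completion) auto
      also have "\<dots> = (LINT x|lebesgue. f x)"
        using g(1) f_int fg by (intro integral_cong_AE) (auto intro: measurable_completion)
      also have "\<dots> = (LINT x|lebesgue. indicator (box a b) x * f x)"
        by (intro Bochner_Integration.integral_cong) (auto simp: f_def indicator_def)
      finally show ?thesis using box0 by simp
    qed
    have "AE x in lborel. g x = 0"
      using g_int g_box g_total by (rule AE_eq_0_of_box_integrals)
    then have "AE x in lborel. x \<in> box a b \<longrightarrow> h x = 0"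
      using g(2) by eventually_elim (auto simp: f_def)
    then show ?thesis by (rule AE_completion)
  qed
  define \<B> where "\<B> = {box a b |a b. cbox a b \<subseteq> \<Omega>}"
  have "\<And>X. X \<in> \<B> \<Longrightarrow> open X" by (auto simp: \<B>_def)
  then obtain \<D> where \<D>: "\<D> \<subseteq> \<B>" "countable \<D>" "\<Union>\<D> = \<Union>\<B>" by (rule Lindelof)
  have "\<Omega> \<subseteq> \<Union>\<B>"
  proof
    fix x assume "x \<in> \<Omega>"
    from open_contains_cbox[OF \<open>open \<Omega>\<close> this] obtain a b where "cbox a b \<subseteq> \<Omega>" "x \<in> box a b" .
    then have "box a b \<in> \<B>" unfolding \<B>_def by auto
    with \<open>x \<in> box a b\<close> show "x \<in> \<Union>\<B>" by auto
  qed
  have "AE x in lebesgue. \<forall>X\<in>\<D>. x \<in> X \<longrightarrow> h x = 0"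
    using \<D>(1) on_box by (subst AE_ball_countable[OF \<D>(2)]) (auto simp: \<B>_def)
  then have "AE x in lebesgue. x \<in> \<Omega> \<longrightarrow> h x = 0"
  proof eventually_elim
    case (elim x)
    show ?case
    proof
      assume "x \<in> \<Omega>"
      then have "x \<in> \<Union>\<D>" unfolding \<D>(3) by (rule subsetD[OF \<open>\<Omega> \<subseteq> \<Union>\<B>\<close>])
      with elim show "h x = 0" by auto
    qed
  qed
  then show ?thesis using \<Omega> by (subst AE_restrict_space_iff) auto
qed

section \<open>Weak gradients\<close>

text \<open>The difference quotients of \<open>F\<close> in direction \<open>c\<close> have integral zero by translation invariance, and they converge
boundedly to the derivative while vanishing outside a fixed ball.\<close>

lemma integral_directional_derivative_eq_0:
  fixes F :: "'a::euclidean_space \<Rightarrow> real" and c :: 'a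
  assumes deriv: "\<And>x. (F has_derivative F' x) (at x)"
    and cont: "continuous_on UNIV (\<lambda>x. F' x c)"
    and supp: "\<And>x. R < norm x \<Longrightarrow> F x = 0"
  shows "(LINT x|lborel. F' x c) = 0"
proof -
  define r where "r = R + norm c"
  have contF: "continuous_on UNIV F"
    using deriv by (auto intro!: continuous_at_imp_continuous_on has_derivative_continuous)
  have mF: "F \<in> borel_measurable lborel" "(\<lambda>x. F' x c) \<in> borel_measurable lborel"
    using contF cont by (auto intro: borel_measurable_continuous_onI)
  have deriv_line: "((\<lambda>s. F (x + s *\<^sub>R c)) has_real_derivative F' (x + s *\<^sub>R c) c) (at s)" for x s
  proof -
    have "((\<lambda>s. x + s *\<^sub>R c) has_derivative (\<lambda>h. h *\<^sub>R c)) (at s)"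
      by (auto intro!: derivative_eq_intros)
    from has_derivative_compose[OF this deriv]
    have "((\<lambda>s. F (x + s *\<^sub>R c)) has_derivative (\<lambda>h. F' (x + s *\<^sub>R c) (h *\<^sub>R c))) (at s)" .
    moreover have "F' (x + s *\<^sub>R c) (h *\<^sub>R c) = F' (x + s *\<^sub>R c) c * h" for h
      using has_derivative_bounded_linear[OF deriv[of "x + s *\<^sub>R c"]]
      by (simp add: linear_simps(5) mult.commute)
    ultimately show ?thesis by (simp add: has_field_derivative_def)
  qed
  have "compact ((\<lambda>x. F' x c) ` cball 0 (r + norm c))"
    using cont by (intro compact_continuous_image compact_cball) (auto intro: continuous_on_subset)
  then obtain B where B: "\<And>x. x \<in> cball 0 (r + norm c) \<Longrightarrow> \<bar>F' x c\<bar> \<le> B" "0 < B"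
    by (auto simp: bounded_pos dest!: compact_imp_bounded) (meson mem_cball_0)
  \<comment> \<open>Difference quotients with step \<open>1 / (n + 1)\<close>; they live in the ball of radius \<open>r\<close>, and the points given by the mean value theorem lie within \<open>norm c\<close> of it.\<close>
  define g where "g n x = (F (x + (1 / real (Suc n)) *\<^sub>R c) - F x) * real (Suc n)" for n x
  have F_int: "integrable lborel F"
  proof -
    have "integrable lborel (\<lambda>x. indicator (cball 0 R) x *\<^sub>R F x)"
      using contF by (intro borel_integrable_compact) (auto intro: continuous_on_subset)
    moreover have "(\<lambda>x. indicator (cball 0 R) x *\<^sub>R F x) = F"
      using supp by (auto simp: indicator_def not_le fun_eq_iff)
    ultimately show ?thesis by (simp only:)
  qed
  have translate: "integrable lborel (\<lambda>x. F (x + d))" "(LINT x|lborel. F (x + d)) = (LINT x|lborel. F x)" for d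
  proof -
    have "integrable (distr lborel borel ((+) d)) F" using F_int by (simp add: lborel_distr_plus)
    then show "integrable lborel (\<lambda>x. F (x + d))"
      using mF by (subst (asm) integrable_distr_eq) (auto simp: add.commute)
    have "(LINT x|lborel. F x) = (LINT x|distr lborel borel ((+) d). F x)" by (simp add: lborel_distr_plus)
    also have "\<dots> = (LINT x|lborel. F (d + x))"
      using mF by (intro integral_distr) auto
    finally show "(LINT x|lborel. F (x + d)) = (LINT x|lborel. F x)" by (simp add: add.commute)
  qed
  have "(\<lambda>n. LINT x|lborel. g n x) \<longlonglongrightarrow> (LINT x|lborel. F' x c)"
  proof (rule integral_dominated_convergence)
    show "(\<lambda>x. F' x c) \<in> borel_measurable lborel" by (rule mF)
    show "g n \<in> borel_measurable lborel" for n
      using translate(1) F_int unfolding g_def by (intro borel_measurable_times borel_measurable_diff) auto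
    show "integrable lborel (\<lambda>x. B * indicator (cball (0::'a) r) x)"
      using emeasure_compact_finite[OF compact_cball, of "0::'a" r]
      by (intro integrable_mult_right integrable_real_indicator) auto
    show "AE x in lborel. (\<lambda>n. g n x) \<longlonglongrightarrow> F' x c"
    proof (rule AE_I2)
      fix x
      have "((\<lambda>h. (F (x + (0 + h) *\<^sub>R c) - F (x + 0 *\<^sub>R c)) / h) \<longlongrightarrow> F' x c) (at 0)"
        using deriv_line[of x 0] unfolding DERIV_def by simp
      then have "((\<lambda>h. (F (x + h *\<^sub>R c) - F x) / h) \<longlongrightarrow> F' x c) (at 0)" by simp
      moreover have "filterlim (\<lambda>n. 1 / real (Suc n)) (at 0) sequentially"
      proof -
        have "(\<lambda>n. 1 / real (Suc n)) \<longlonglongrightarrow> 0" by (rule LIMSEQ_Suc[OF lim_1_over_n])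
        then show ?thesis by (simp add: filterlim_at)
      qed
      ultimately have "(\<lambda>n. (F (x + (1 / real (Suc n)) *\<^sub>R c) - F x) / (1 / real (Suc n))) \<longlonglongrightarrow> F' x c"
        by (rule filterlim_compose)
      then show "(\<lambda>n. g n x) \<longlonglongrightarrow> F' x c" by (simp add: g_def)
    qed
    show "AE x in lborel. norm (g n x) \<le> B * indicator (cball 0 r) x" for n
    proof (rule AE_I2)
      fix x
      let ?h = "1 / real (Suc n)"
      have h: "0 < ?h" "?h \<le> 1" by (auto simp: divide_simps)
      have near: "norm (s *\<^sub>R c) \<le> norm c" if "0 \<le> s" "s \<le> ?h" for s
      proof -
        have "\<bar>s\<bar> * norm c \<le> 1 * norm c" using order_trans[OF that(2) h(2)] that(1) by (intro mult_right_mono) auto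
        then show ?thesis by simp
      qed
      show "norm (g n x) \<le> B * indicator (cball 0 r) x"
      proof (cases "norm x \<le> r")
        case True
        obtain z where z: "0 < z" "z < ?h" "F (x + ?h *\<^sub>R c) - F (x + 0 *\<^sub>R c) = (?h - 0) * F' (x + z *\<^sub>R c) c"
          using MVT2[OF h(1), of "\<lambda>s. F (x + s *\<^sub>R c)" "\<lambda>s. F' (x + s *\<^sub>R c) c"] deriv_line by blast
        have "norm (x + z *\<^sub>R c) \<le> r + norm c"
          using norm_triangle_ineq[of x "z *\<^sub>R c"] near[of z] z True by simp
        then have "\<bar>F' (x + z *\<^sub>R c) c\<bar> \<le> B" by (intro B) simp
        moreover have "g n x = F' (x + z *\<^sub>R c) c" using z(3) by (simp add: g_def field_simps)
        ultimately show ?thesis using True by simp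
      next
        case False
        have "norm x \<le> norm (x + ?h *\<^sub>R c) + norm (?h *\<^sub>R c)"
          using norm_triangle_ineq4[of "x + ?h *\<^sub>R c" "?h *\<^sub>R c"] by simp
        then have "R < norm (x + ?h *\<^sub>R c)" using near[of ?h] h False by (simp add: r_def)
        moreover have "R < norm x" using False norm_ge_zero[of c] by (simp add: r_def del: norm_ge_zero)
        ultimately show ?thesis using supp False by (simp add: g_def)
      qed
    qed
  qed
  moreover have "(LINT x|lborel. g n x) = 0" for n
    unfolding g_def using translate F_int by simp
  ultimately show ?thesis by (simp add: LIMSEQ_const_iff)
qed

lemma Ck_imp_continuous: "Ck k \<phi> \<Longrightarrow> continuous_on UNIV \<phi>"
  by (cases k) (auto intro!: continuous_at_imp_continuous_on differentiable_imp_continuous_within)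

lemma Ck_diff: "Ck k \<phi> \<Longrightarrow> Ck k \<psi> \<Longrightarrow> Ck k (\<lambda>x. \<phi> x - \<psi> x)"
proof (induction k arbitrary: \<phi> \<psi>)
  case (Suc k)
  have "frechet_derivative (\<lambda>x. \<phi> x - \<psi> x) (at x)
      = (\<lambda>h. frechet_derivative \<phi> (at x) h - frechet_derivative \<psi> (at x) h)" for x
    using Suc.prems
    by (intro frechet_derivative_at[symmetric] has_derivative_diff)
      (auto simp: frechet_derivative_works)
  then show ?case using Suc by auto
qed (auto intro: continuous_on_diff)

lemma test_function_diff:
  assumes "\<phi> \<in> test_functions \<Omega>" "\<psi> \<in> test_functions \<Omega>"
  shows "(\<lambda>x. \<phi> x - \<psi> x) \<in> test_functions \<Omega>"
proof -
  let ?s = "\<lambda>\<phi>. closure {x. \<phi> x \<noteq> (0::real)}"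
  have "{x. \<phi> x - \<psi> x \<noteq> 0} \<subseteq> {x. \<phi> x \<noteq> 0} \<union> {x. \<psi> x \<noteq> 0}" by auto
  then have sub: "?s (\<lambda>x. \<phi> x - \<psi> x) \<subseteq> ?s \<phi> \<union> ?s \<psi>"
    unfolding closure_Un[symmetric] by (rule closure_mono)
  moreover have "compact (?s \<phi> \<union> ?s \<psi>)" using assms by (auto simp: test_functions_def)
  ultimately have "compact (?s (\<lambda>x. \<phi> x - \<psi> x))"
    using compact_Int_closed[of "?s \<phi> \<union> ?s \<psi>" "?s (\<lambda>x. \<phi> x - \<psi> x)"]
    by (simp add: Int_absorb1)
  with sub assms show ?thesis by (auto simp: test_functions_def intro!: Ck_diff)
qed

context
  fixes \<Omega> :: "'a::euclidean_space set" and \<phi> :: "'a \<Rightarrow> real"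
  assumes \<phi>: "\<phi> \<in> test_functions \<Omega>"
begin

lemma test_has_derivative: "(\<phi> has_derivative frechet_derivative \<phi> (at x)) (at x)"
proof -
  have "Ck (Suc 0) \<phi>" using \<phi> unfolding test_functions_def by blast
  then show ?thesis by (simp add: frechet_derivative_works)
qed

lemma test_partial_Ck: "b \<in> Basis \<Longrightarrow> Ck k (\<lambda>x. frechet_derivative \<phi> (at x) b)"
proof -
  have "Ck (Suc k) \<phi>" using \<phi> unfolding test_functions_def by blast
  then show "b \<in> Basis \<Longrightarrow> ?thesis" by simp
qed

lemma test_continuous: "continuous_on UNIV \<phi>"
  using \<phi> Ck_imp_continuous unfolding test_functions_def by blast

lemma test_bounded_support: "\<exists>R. \<forall>x. R < norm x \<longrightarrow> \<phi> x = 0"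
proof -
  have "bounded (closure {x. \<phi> x \<noteq> 0})"
    using \<phi> by (auto simp: test_functions_def intro: compact_imp_bounded)
  then obtain R where "\<And>x. x \<in> closure {x. \<phi> x \<noteq> 0} \<Longrightarrow> norm x \<le> R"
    by (auto simp: bounded_iff)
  then show ?thesis using closure_subset[of "{x. \<phi> x \<noteq> 0}"] by (meson mem_Collect_eq not_le subsetD)
qed

lemma test_zero_outside: "x \<notin> \<Omega> \<Longrightarrow> \<phi> x = 0"
  using \<phi> closure_subset[of "{x. \<phi> x \<noteq> 0}"] by (auto simp: test_functions_def)

lemma classical_grad_inner: "b \<in> Basis \<Longrightarrow> classical_grad \<phi> x \<bullet> b = frechet_derivative \<phi> (at x) b"
  by (simp add: classical_grad_def inner_sum_left inner_Basis if_distrib cong: if_cong)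

lemma classical_grad_continuous: "continuous_on UNIV (classical_grad \<phi>)"
  unfolding classical_grad_def[abs_def]
  by (intro continuous_intros Ck_imp_continuous[OF test_partial_Ck])

end

lemma continuous_bounded_L2:
  fixes v :: "'a::euclidean_space \<Rightarrow> 'b::euclidean_space"
  assumes "continuous_on UNIV v" "bounded \<Omega>" "\<Omega> \<in> sets lebesgue"
  shows "v \<in> L2 \<Omega>"
proof -
  have \<Omega>: "\<Omega> \<in> lmeasurable" using assms by (simp add: bounded_set_imp_lmeasurable)
  have "compact ((\<lambda>x. (norm (v x))\<^sup>2) ` closure \<Omega>)"
    using assms by (intro compact_continuous_image continuous_intros)
      (auto intro: continuous_on_subset)
  then have "bounded ((\<lambda>x. (norm (v x))\<^sup>2) ` closure \<Omega>)" by (rule compact_imp_bounded)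
  then obtain B where "\<And>x. x \<in> closure \<Omega> \<Longrightarrow> norm ((norm (v x))\<^sup>2) \<le> B"
    unfolding bounded_iff by blast
  then have B: "\<And>x. x \<in> \<Omega> \<Longrightarrow> norm ((norm (v x))\<^sup>2) \<le> B" using closure_subset by blast
  have v: "v \<in> borel_measurable (lebesgue_on \<Omega>)"
    using assms by (intro continuous_imp_measurable_on_sets_lebesgue) (auto intro: continuous_on_subset)
  have "integrable (lebesgue_on \<Omega>) (\<lambda>x. (norm (v x))\<^sup>2)"
    using finite_measure_lebesgue_on[OF \<Omega>] B v
    by (intro finite_measure.integrable_const_bound[where B = B] AE_I2) auto
  with v show ?thesis by (simp add: L2_def)
qed

locale bounded_open =
  fixes \<Omega> :: "'a::euclidean_space set"
  assumes open_\<Omega>: "open \<Omega>" and bounded_\<Omega>: "bounded \<Omega>" and nonempty_\<Omega>: "\<Omega> \<noteq> {}"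
begin

lemma \<Omega>_meas [simp]: "\<Omega> \<in> sets lebesgue" "\<Omega> \<in> lmeasurable"
  using open_\<Omega> bounded_\<Omega> by (auto intro: bounded_set_imp_lmeasurable)

lemma test_L2: "\<phi> \<in> test_functions \<Omega> \<Longrightarrow> \<phi> \<in> L2 \<Omega>"
  and test_grad_L2: "\<phi> \<in> test_functions \<Omega> \<Longrightarrow> classical_grad \<phi> \<in> L2 \<Omega>"
  and test_partial_L2: "\<phi> \<in> test_functions \<Omega> \<Longrightarrow> b \<in> Basis \<Longrightarrow> (\<lambda>x. classical_grad \<phi> x \<bullet> b) \<in> L2 \<Omega>"
  by (intro continuous_bounded_L2 continuous_intros bounded_\<Omega> \<Omega>_meas;
      erule test_continuous classical_grad_continuous)+

lemma L2_component: "g \<in> L2 \<Omega> \<Longrightarrow> b \<in> Basis \<Longrightarrow> (\<lambda>x. g x \<bullet> b) \<in> L2 \<Omega>"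
  for g :: "'a \<Rightarrow> 'a"
proof -
  assume g: "g \<in> L2 \<Omega>" and b: "b \<in> Basis"
  have m: "(\<lambda>x. g x \<bullet> b) \<in> borel_measurable (lebesgue_on \<Omega>)" using L2_D[OF g] by simp
  have "integrable (lebesgue_on \<Omega>) (\<lambda>x. (norm (g x \<bullet> b))\<^sup>2)"
  proof (rule Bochner_Integration.integrable_bound[OF L2_D(2)[OF g]])
    show "(\<lambda>x. (norm (g x \<bullet> b))\<^sup>2) \<in> borel_measurable (lebesgue_on \<Omega>)" using m by simp
    show "AE x in lebesgue_on \<Omega>. norm ((norm (g x \<bullet> b))\<^sup>2) \<le> norm ((norm (g x))\<^sup>2)"
    proof (rule AE_I2)
      fix x
      have "norm (g x \<bullet> b) \<le> norm (g x)" using Basis_le_norm[OF b, of "g x"] by simp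
      then have "(norm (g x \<bullet> b))\<^sup>2 \<le> (norm (g x))\<^sup>2" by (rule power_mono) simp
      then show "norm ((norm (g x \<bullet> b))\<^sup>2) \<le> norm ((norm (g x))\<^sup>2)" by simp
    qed
  qed
  with m show ?thesis by (simp add: L2_def)
qed

lemma integral_mult_L2: "v \<in> L2 \<Omega> \<Longrightarrow> w \<in> L2 \<Omega> \<Longrightarrow> integrable (lebesgue_on \<Omega>) (\<lambda>x. v x * w x)"
  for v w :: "'a \<Rightarrow> real"
  using L2_inner_integrable[of v \<Omega> w] by simp

lemma is_weak_grad_diff:
  assumes v: "v \<in> L2 \<Omega>" "is_weak_grad \<Omega> v g" and w: "w \<in> L2 \<Omega>" "is_weak_grad \<Omega> w h"
  shows "is_weak_grad \<Omega> (\<lambda>x. v x - w x) (\<lambda>x. g x - h x)"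
  unfolding is_weak_grad_def
proof (intro conjI ballI)
  have g: "g \<in> L2 \<Omega>" and h: "h \<in> L2 \<Omega>" using v w by (auto simp: is_weak_grad_def)
  then show "(\<lambda>x. g x - h x) \<in> L2 \<Omega>" by (rule L2_diff)
  fix \<phi> b assume \<phi>: "\<phi> \<in> test_functions \<Omega>" and b: "b \<in> (Basis :: 'a set)"
  note I = integral_mult_L2[OF v(1) test_partial_L2[OF \<phi> b]] integral_mult_L2[OF w(1) test_partial_L2[OF \<phi> b]]
    integral_mult_L2[OF L2_component[OF g b] test_L2[OF \<phi>]] integral_mult_L2[OF L2_component[OF h b] test_L2[OF \<phi>]]
  have "(LINT x|lebesgue_on \<Omega>. v x * (classical_grad \<phi> x \<bullet> b)) = - (LINT x|lebesgue_on \<Omega>. (g x \<bullet> b) * \<phi> x)"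
    "(LINT x|lebesgue_on \<Omega>. w x * (classical_grad \<phi> x \<bullet> b)) = - (LINT x|lebesgue_on \<Omega>. (h x \<bullet> b) * \<phi> x)"
    using v w \<phi> b by (auto simp: is_weak_grad_def)
  then show "(LINT x|lebesgue_on \<Omega>. (v x - w x) * (classical_grad \<phi> x \<bullet> b))
     = - (LINT x|lebesgue_on \<Omega>. ((g x - h x) \<bullet> b) * \<phi> x)"
    using I by (simp add: left_diff_distrib inner_diff_left)
qed

text \<open>Each component of the difference of two weak gradients annihilates all test functions.\<close>

lemma weak_grad_unique:
  assumes g: "is_weak_grad \<Omega> v g" and h: "is_weak_grad \<Omega> v h"
  shows "AE x in lebesgue_on \<Omega>. g x = h x"
proof -
  have gL: "g \<in> L2 \<Omega>" and hL: "h \<in> L2 \<Omega>" using g h by (auto simp: is_weak_grad_def)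
  have "AE x in lebesgue_on \<Omega>. \<forall>b\<in>Basis. (g x - h x) \<bullet> b = 0"
  proof (rule AE_finite_allI)
    fix b :: 'a assume b: "b \<in> Basis"
    have L: "(\<lambda>x. (g x - h x) \<bullet> b) \<in> L2 \<Omega>" by (intro L2_component L2_diff gL hL b)
    show "AE x in lebesgue_on \<Omega>. (g x - h x) \<bullet> b = 0"
    proof (rule fundamental_lemma_calculus_of_variations[OF L2_integrable[OF L] open_\<Omega>])
      fix \<phi> assume \<phi>: "\<phi> \<in> test_functions \<Omega>"
      have "(LINT x|lebesgue_on \<Omega>. (g x \<bullet> b) * \<phi> x) = (LINT x|lebesgue_on \<Omega>. (h x \<bullet> b) * \<phi> x)"
        using g \<phi> b h[unfolded is_weak_grad_def, THEN conjunct2, rule_format, OF \<phi> b]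
      by (simp add: is_weak_grad_def)
      then show "(LINT x|lebesgue_on \<Omega>. ((g x - h x) \<bullet> b) * \<phi> x) = 0"
        using integral_mult_L2[OF L2_component[OF gL b] test_L2[OF \<phi>]]
          integral_mult_L2[OF L2_component[OF hL b] test_L2[OF \<phi>]]
        by (simp add: left_diff_distrib inner_diff_left)
    qed simp
  qed simp
  then show ?thesis
    by eventually_elim (metis (no_types, lifting) euclidean_all_zero_iff right_minus_eq)
qed

text \<open>Integration by parts: the integral of a partial derivative of \<open>\<phi> \<psi>\<close> vanishes.\<close>

lemma classical_is_weak_grad:
  assumes \<phi>: "\<phi> \<in> test_functions \<Omega>"
  shows "is_weak_grad \<Omega> \<phi> (classical_grad \<phi>)"
  unfolding is_weak_grad_def
proof (intro conjI ballI)
  show "classical_grad \<phi> \<in> L2 \<Omega>" using \<phi> by (rule test_grad_L2)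
  fix \<psi> b assume \<psi>: "\<psi> \<in> test_functions \<Omega>" and b: "b \<in> (Basis :: 'a set)"
  let ?d = "\<lambda>\<phi> x. frechet_derivative \<phi> (at x)"
  let ?G = "\<lambda>x. \<phi> x * ?d \<psi> x b + ?d \<phi> x b * \<psi> x"
  obtain R where R: "\<And>x. R < norm x \<Longrightarrow> \<phi> x = 0" using test_bounded_support[OF \<phi>] by blast
  have cont: "continuous_on UNIV ?G"
    using Ck_imp_continuous test_partial_Ck \<phi> \<psi> b
    by (intro continuous_intros test_continuous[OF \<phi>] test_continuous[OF \<psi>]) blast+
  have "(LINT x|lborel. ?G x) = 0"
    by (rule integral_directional_derivative_eq_0[where F = "\<lambda>x. \<phi> x * \<psi> x" and R = R
        and F' = "\<lambda>x h. \<phi> x * ?d \<psi> x h + ?d \<phi> x h * \<psi> x"])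
      (use R cont in \<open>auto intro!: has_derivative_mult test_has_derivative[OF \<phi>] test_has_derivative[OF \<psi>]\<close>)
  also have "(LINT x|lborel. ?G x) = (LINT x|lebesgue. ?G x)"
    using borel_measurable_continuous_onI[OF cont] by (subst integral_completion) auto
  also have "\<dots> = (LINT x|lebesgue. indicator \<Omega> x *\<^sub>R ?G x)"
    using test_zero_outside[OF \<phi>] test_zero_outside[OF \<psi>]
    by (intro Bochner_Integration.integral_cong) (auto simp: indicator_def)
  also have "\<dots> = (LINT x|lebesgue_on \<Omega>. ?G x)"
    by (subst integral_restrict_space) auto
  also have "\<dots> = (LINT x|lebesgue_on \<Omega>. \<phi> x * (classical_grad \<psi> x \<bullet> b))
      + (LINT x|lebesgue_on \<Omega>. (classical_grad \<phi> x \<bullet> b) * \<psi> x)"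
    using integral_mult_L2[OF test_L2[OF \<phi>] test_partial_L2[OF \<psi> b]]
      integral_mult_L2[OF test_partial_L2[OF \<phi> b] test_L2[OF \<psi>]]
    by (simp add: classical_grad_inner[OF \<phi> b] classical_grad_inner[OF \<psi> b])
  finally show "(LINT x|lebesgue_on \<Omega>. \<phi> x * (classical_grad \<psi> x \<bullet> b))
     = - (LINT x|lebesgue_on \<Omega>. (classical_grad \<phi> x \<bullet> b) * \<psi> x)" by simp
qed

lemma weak_grad_works: "v \<in> H1 \<Omega> \<Longrightarrow> is_weak_grad \<Omega> v (weak_grad \<Omega> v)"
  unfolding H1_def weak_grad_def by (blast intro: someI_ex[of "is_weak_grad \<Omega> v"])

lemma weak_grad_L2: "v \<in> H1 \<Omega> \<Longrightarrow> weak_grad \<Omega> v \<in> L2 \<Omega>"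
  using weak_grad_works by (auto simp: is_weak_grad_def)

lemma H1_L2: "v \<in> H1 \<Omega> \<Longrightarrow> v \<in> L2 \<Omega>"
  by (simp add: H1_def)

lemma H1_diff: "v \<in> H1 \<Omega> \<Longrightarrow> w \<in> H1 \<Omega> \<Longrightarrow> (\<lambda>x. v x - w x) \<in> H1 \<Omega>"
  unfolding H1_def by (auto intro: L2_diff is_weak_grad_diff)

text \<open>Uniqueness makes the choice of representatives harmless: it is linear up to null sets.\<close>

lemma weak_grad_diff:
  assumes "v \<in> H1 \<Omega>" "w \<in> H1 \<Omega>"
  shows "AE x in lebesgue_on \<Omega>. weak_grad \<Omega> (\<lambda>x. v x - w x) x = weak_grad \<Omega> v x - weak_grad \<Omega> w x"
  by (intro weak_grad_unique[OF weak_grad_works[OF H1_diff]] is_weak_grad_diff H1_L2 weak_grad_works assms)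

lemma test_H1: "\<phi> \<in> test_functions \<Omega> \<Longrightarrow> \<phi> \<in> H1 \<Omega>"
  unfolding H1_def using test_L2 classical_is_weak_grad by blast

lemma H1_norm_triangle:
  assumes v: "v \<in> H1 \<Omega>" and w: "w \<in> H1 \<Omega>"
  shows "H1_norm \<Omega> (\<lambda>x. v x - w x) \<le> H1_norm \<Omega> v + H1_norm \<Omega> w"
proof -
  let ?n = "L2_norm \<Omega>" and ?g = "weak_grad \<Omega>"
  have "?n (?g (\<lambda>x. v x - w x)) = ?n (\<lambda>x. ?g v x - ?g w x)"
    by (intro L2_norm_AE_cong weak_grad_diff L2_diff weak_grad_L2 H1_diff v w)
  also have "\<dots> \<le> ?n (?g v) + ?n (?g w)" by (intro L2_norm_triangle weak_grad_L2 v w)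
  finally have "H1_norm \<Omega> (\<lambda>x. v x - w x) \<le> sqrt ((?n v + ?n w)\<^sup>2 + (?n (?g v) + ?n (?g w))\<^sup>2)"
    unfolding H1_norm_def
    by (intro real_sqrt_le_mono add_mono power_mono L2_norm_triangle H1_L2 v w L2_norm_nonneg)
  also have "\<dots> \<le> H1_norm \<Omega> v + H1_norm \<Omega> w"
    unfolding H1_norm_def by (rule real_sqrt_sum_squares_triangle_ineq)
  finally show ?thesis .
qed

lemma H10_H1: "v \<in> H10 \<Omega> \<Longrightarrow> v \<in> H1 \<Omega>"
  by (simp add: H10_def)

lemma H10_diff:
  assumes v: "v \<in> H10 \<Omega>" and w: "w \<in> H10 \<Omega>"
  shows "(\<lambda>x. v x - w x) \<in> H10 \<Omega>"
proof -
  have "\<exists>\<xi>\<in>test_functions \<Omega>. H1_norm \<Omega> (\<lambda>x. v x - w x - \<xi> x) < e" if "0 < e" for e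
  proof -
    have "0 < e / 2" using that by simp
    obtain \<phi> where \<phi>: "\<phi> \<in> test_functions \<Omega>" "H1_norm \<Omega> (\<lambda>x. v x - \<phi> x) < e / 2"
      using v \<open>0 < e / 2\<close> unfolding H10_def by blast
    obtain \<psi> where \<psi>: "\<psi> \<in> test_functions \<Omega>" "H1_norm \<Omega> (\<lambda>x. w x - \<psi> x) < e / 2"
      using w \<open>0 < e / 2\<close> unfolding H10_def by blast
    have "H1_norm \<Omega> (\<lambda>x. (v x - \<phi> x) - (w x - \<psi> x)) \<le> H1_norm \<Omega> (\<lambda>x. v x - \<phi> x) + H1_norm \<Omega> (\<lambda>x. w x - \<psi> x)"
      by (intro H1_norm_triangle H1_diff H10_H1 test_H1 v w \<phi> \<psi>)
    moreover have "(\<lambda>x. (v x - \<phi> x) - (w x - \<psi> x)) = (\<lambda>x. v x - w x - (\<phi> x - \<psi> x))"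
      by (auto simp: algebra_simps)
    ultimately have "H1_norm \<Omega> (\<lambda>x. v x - w x - (\<phi> x - \<psi> x)) < e" using \<phi>(2) \<psi>(2) by simp
    then show ?thesis using test_function_diff[OF \<phi>(1) \<psi>(1)] by (intro bexI) 
  qed
  then show ?thesis using H1_diff[OF H10_H1[OF v] H10_H1[OF w]] by (simp add: H10_def)
qed

lemma test_H10:
  assumes \<phi>: "\<phi> \<in> test_functions \<Omega>" shows "\<phi> \<in> H10 \<Omega>"
proof -
  have "L2_norm \<Omega> (weak_grad \<Omega> (\<lambda>x. \<phi> x - \<phi> x)) = L2_norm \<Omega> (\<lambda>x. weak_grad \<Omega> \<phi> x - weak_grad \<Omega> \<phi> x)"
    by (intro L2_norm_AE_cong weak_grad_diff L2_diff weak_grad_L2 H1_diff test_H1 \<phi>)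
  then have "H1_norm \<Omega> (\<lambda>x. \<phi> x - \<phi> x) = 0"
    by (simp add: H1_norm_def L2_norm_def L2_inner_def)
  then have "\<exists>\<psi>\<in>test_functions \<Omega>. H1_norm \<Omega> (\<lambda>x. \<phi> x - \<psi> x) < e" if "0 < e" for e
    using \<phi> that by (intro bexI[of _ \<phi>]) simp_all
  then show ?thesis using test_H1[OF \<phi>] by (simp add: H10_def)
qed

text \<open>A box bump in \<open>\<Omega>\<close> has positive norm, so a negative constant would contradict the embedding.\<close>

lemma embedding_constant_nonneg:
  assumes emb: "\<And>v. v \<in> H10 \<Omega> \<Longrightarrow> L2_norm \<Omega> v \<le> C * L2_norm \<Omega> (weak_grad \<Omega> v)"
  shows "0 \<le> C"
proof (rule ccontr)
  assume C: "\<not> 0 \<le> C"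
  obtain x0 where "x0 \<in> \<Omega>" using nonempty_\<Omega> by blast
  with open_\<Omega> obtain a b where ab: "cbox a b \<subseteq> \<Omega>" "x0 \<in> box a b" by (rule open_contains_cbox)
  define \<phi> where "\<phi> = box_bump a b 1"
  have \<phi>: "\<phi> \<in> test_functions \<Omega>" unfolding \<phi>_def using ab by (intro box_bump_test_function) auto
  have "C * L2_norm \<Omega> (weak_grad \<Omega> \<phi>) \<le> 0"
    using C by (intro mult_nonpos_nonneg) (auto simp: L2_norm_nonneg)
  then have "L2_norm \<Omega> \<phi> \<le> 0" using emb[OF test_H10[OF \<phi>]] by simp
  then have "L2_norm \<Omega> \<phi> = 0" using L2_norm_nonneg[of \<Omega> \<phi>] by simp
  then have "(LINT x|lebesgue_on \<Omega>. (norm (\<phi> x))\<^sup>2) = 0"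
    by (simp add: L2_norm_def L2_inner_def power2_eq_square)
  then have "AE x in lebesgue_on \<Omega>. (norm (\<phi> x))\<^sup>2 = 0"
    using L2_D(2)[OF test_L2[OF \<phi>]] by (subst (asm) integral_nonneg_eq_0_iff_AE) auto
  then have "AE x in lebesgue. x \<in> \<Omega> \<longrightarrow> \<phi> x = 0"
    by (subst (asm) AE_restrict_space_iff) auto
  then have "AE x in lebesgue. x \<notin> box a b"
  proof eventually_elim
    case (elim x)
    then show ?case using ab(1) box_subset_cbox[of a b] box_bump_nonzero_iff[of a b 1 x] by (auto simp: \<phi>_def)
  qed
  then have "negligible (box a b)"
    by (simp add: negligible_iff_null_sets AE_iff_null_sets)
  moreover have "\<not> negligible (box a b)"
    using ab(2) by (intro open_not_negligible) auto
  ultimately show False by contradiction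
qed

end

section \<open>The energy estimate\<close>

lemma L2_norm_le_Linf:
  assumes "f \<in> Linf_L2 \<Omega>" "0 \<le> s"
  shows "L2_norm \<Omega> (f s) \<le> Linf_norm \<Omega> f"
  using assms unfolding Linf_norm_def Linf_L2_def by (intro cSUP_upper) auto

lemma variation_le_BV:
  fixes s :: "nat \<Rightarrow> real" and N :: nat
  assumes "f \<in> BV_L2 \<Omega>" "0 \<le> s 0" "\<And>i. i \<in> {1..N} \<Longrightarrow> s (i - 1) < s i"
  shows "(\<Sum>i=1..N. L2_norm \<Omega> (\<lambda>x. f (s i) x - f (s (i - 1)) x)) \<le> BV_norm \<Omega> f"
  unfolding BV_norm_def
proof (rule cSup_upper)
  show "(\<Sum>i=1..N. L2_norm \<Omega> (\<lambda>x. f (s i) x - f (s (i - 1)) x)) \<in> variation_sums \<Omega> f"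
    unfolding variation_sums_def using assms(2,3)
    by (intro CollectI exI[of _ s] exI[of _ N] conjI ballI refl)
qed (use assms(1) in \<open>simp add: BV_L2_def\<close>)

lemma summation_by_parts:
  fixes f u :: "nat \<Rightarrow> 'a::euclidean_space \<Rightarrow> real"
  assumes f: "\<And>k. f k \<in> L2 \<Omega>" and u: "\<And>k. u k \<in> L2 \<Omega>"
  shows "(\<Sum>k=1..Suc n. L2_inner \<Omega> (f k) (\<lambda>x. u k x - u (k - 1) x))
    = L2_inner \<Omega> (f (Suc n)) (u (Suc n)) - L2_inner \<Omega> (f 1) (u 0)
      - (\<Sum>i=1..n. L2_inner \<Omega> (\<lambda>x. f (Suc i) x - f i x) (u i))"
  using f u by (induction n) (auto simp: L2_inner_diff_right L2_inner_diff_left)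

text \<open>The hypothesis is the energy inequality at a level \<open>m\<close> where \<open>N\<close> is at least as large as before. Choosing for
\<open>m\<close> the maximiser over all levels up to \<open>n\<close> lets one factor \<open>N m\<close> be cancelled.\<close>

lemma max_step_bound:
  fixes N :: "nat \<Rightarrow> real"
  assumes N: "\<And>k. 0 \<le> N k" and K: "0 \<le> K"
    and step: "\<And>m. 1 \<le> m \<Longrightarrow> (\<And>k. k \<le> m \<Longrightarrow> N k \<le> N m) \<Longrightarrow> (N m)\<^sup>2 \<le> (N 0)\<^sup>2 + 2 * K * N m"
  shows "N n \<le> N 0 + 2 * K"
proof -
  have "Max (N ` {..n}) \<in> N ` {..n}" by (intro Max_in) auto
  then obtain m where Max: "Max (N ` {..n}) = N m" and "m \<in> {..n}" by (rule imageE)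
  then have m: "m \<le> n" by simp
  have max: "N k \<le> N m" if "k \<le> n" for k unfolding Max[symmetric] using that by simp
  have "N m \<le> N 0 + 2 * K"
  proof (cases "m = 0")
    case False
    have "N m * N m \<le> (N 0)\<^sup>2 + 2 * K * N m"
      using step[of m] False max m by (simp add: power2_eq_square)
    also have "(N 0)\<^sup>2 \<le> N 0 * N m"
      unfolding power2_eq_square using N max by (intro mult_left_mono) auto
    finally have "N m * N m \<le> (N 0 + 2 * K) * N m" by (simp add: algebra_simps)
    then show ?thesis using N[of m] N[of 0] K by (cases "N m = 0") auto
  qed (use K in simp)
  with max[of n] show ?thesis by simp
qed

text \<open>The operator acts on the time index only, so the quadratic form may be evaluated at each point of \<open>\<Omega>\<close> before
integrating.\<close>

lemma (in fast_mesh) fast_form_integral_nonneg: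
  assumes u: "\<And>k. u k \<in> L2 \<Omega>"
  shows "0 \<le> (\<Sum>k=1..n. L2_inner \<Omega> (fast_L21sigma K \<alpha> \<sigma> t u k) (\<lambda>x. u k x - u (k - 1) x))"
proof -
  define F where "F = fast_L21sigma K \<alpha> \<sigma> t u"
  define \<delta> where "\<delta> k x = u k x - u (k - 1) x" for k x
  have \<delta>: "\<delta> k \<in> L2 \<Omega>" for k
    unfolding \<delta>_def[abs_def] by (intro L2_diff u)
  have scale: "(\<lambda>x. c * v x) \<in> L2 \<Omega>" if "v \<in> L2 \<Omega>" for c and v :: "_ \<Rightarrow> real"
    using L2_scaleR[OF that, of c] by simp
  have F: "F k \<in> L2 \<Omega>" for k
    unfolding F_def fast_L21sigma_def[abs_def] \<delta>_def[symmetric]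
    by (intro L2_add scale L2_sum \<delta>)
  have int: "integrable (lebesgue_on \<Omega>) (\<lambda>x. F k x \<bullet> \<delta> k x)" for k
    using F \<delta> by (rule L2_inner_integrable)
  have "0 \<le> (LINT x|lebesgue_on \<Omega>. (\<Sum>k=1..n. F k x \<bullet> \<delta> k x))"
  proof (rule Bochner_Integration.integral_nonneg)
    fix x
    show "0 \<le> (\<Sum>k=1..n. F k x \<bullet> \<delta> k x)"
      using fast_form_nonneg[of "\<lambda>k. \<delta> k x" n]
      by (simp add: F_def fast_L21sigma_def \<delta>_def mult.commute)
  qed
  also have "\<dots> = (\<Sum>k=1..n. L2_inner \<Omega> (F k) (\<delta> k))"
    using int by (simp add: L2_inner_def)
  finally show ?thesis by (simp add: F_def \<delta>_def[abs_def])
qed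

text \<open>With \<open>g\<close> and \<open>h\<close> the two gradients, \<open>(1 - \<alpha>/2) g + (\<alpha>/2) h\<close> is the mean of \<open>g\<close> and \<open>h\<close> plus
\<open>(1 - \<alpha>)/2\<close> times \<open>g - h\<close>. The mean produces the difference of the squared norms, the rest a nonnegative multiple
of \<open>\<parallel>g - h\<parallel>\<^sup>2\<close>.\<close>

lemma (in bounded_open) gradient_step:
  assumes \<alpha>: "0 < \<alpha>" "\<alpha> < 1" and v: "v \<in> H1 \<Omega>" and w: "w \<in> H1 \<Omega>"
  shows "((L2_norm \<Omega> (weak_grad \<Omega> v))\<^sup>2 - (L2_norm \<Omega> (weak_grad \<Omega> w))\<^sup>2) / 2
    \<le> L2_inner \<Omega> (\<lambda>x. (1 - \<alpha> / 2) *\<^sub>R weak_grad \<Omega> v x + (\<alpha> / 2) *\<^sub>R weak_grad \<Omega> w x)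
        (weak_grad \<Omega> (\<lambda>x. v x - w x))"
proof -
  define g where "g = weak_grad \<Omega> v"
  define h where "h = weak_grad \<Omega> w"
  have gh: "g \<in> L2 \<Omega>" "h \<in> L2 \<Omega>" unfolding g_def h_def by (intro weak_grad_L2 v w)+
  let ?G = "\<lambda>x. (1 - \<alpha> / 2) *\<^sub>R g x + (\<alpha> / 2) *\<^sub>R h x"
  have G: "?G \<in> L2 \<Omega>" by (intro L2_add L2_scaleR gh)
  have "L2_inner \<Omega> (weak_grad \<Omega> (\<lambda>x. v x - w x)) ?G = L2_inner \<Omega> (\<lambda>x. g x - h x) ?G"
    using weak_grad_diff[OF v w]
    by (intro L2_inner_AE_cong weak_grad_L2 H1_diff L2_diff G gh v w) (simp add: g_def h_def)
  then have "L2_inner \<Omega> ?G (weak_grad \<Omega> (\<lambda>x. v x - w x)) = L2_inner \<Omega> ?G (\<lambda>x. g x - h x)"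
    by (simp only: L2_inner_commute[of \<Omega> ?G])
  also have "\<dots> = (1 - \<alpha> / 2) * (L2_inner \<Omega> g g - L2_inner \<Omega> g h) + \<alpha> / 2 * (L2_inner \<Omega> g h - L2_inner \<Omega> h h)"
    using gh G
    by (simp add: L2_inner_add_left L2_inner_scaleR_left L2_inner_diff_right L2_scaleR L2_diff L2_inner_commute[of \<Omega> h g])
  also have "\<dots> = (L2_inner \<Omega> g g - L2_inner \<Omega> h h) / 2
      + (1 - \<alpha>) / 2 * (L2_inner \<Omega> g g - 2 * L2_inner \<Omega> g h + L2_inner \<Omega> h h)"
    by (simp add: field_simps)
  also have "L2_inner \<Omega> g g - 2 * L2_inner \<Omega> g h + L2_inner \<Omega> h h = L2_inner \<Omega> (\<lambda>x. g x - h x) (\<lambda>x. g x - h x)"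
    using gh by (simp add: L2_inner_diff_left L2_inner_diff_right L2_diff L2_inner_commute[of \<Omega> h g])
  finally show ?thesis
    using \<alpha> L2_inner_self_nonneg[of \<Omega> "\<lambda>x. g x - h x"]
    by (simp add: L2_norm_sq g_def[symmetric] h_def[symmetric])
qed

text \<open>Summation by parts moves the differences onto \<open>f\<close>: the two boundary terms cost the supremum norm each, the remaining
sum at most the total variation.\<close>

lemma source_term_le:
  fixes u :: "nat \<Rightarrow> 'a::euclidean_space \<Rightarrow> real"
  assumes f: "f \<in> Linf_L2 \<Omega>" "f \<in> BV_L2 \<Omega>"
    and u: "\<And>k. u k \<in> L2 \<Omega>" and M: "\<And>k. k \<le> m \<Longrightarrow> L2_norm \<Omega> (u k) \<le> M"
    and s: "0 \<le> s 1" "\<And>k. 1 \<le> k \<Longrightarrow> s k < s (Suc k)" and m: "1 \<le> m"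
  shows "(\<Sum>k=1..m. L2_inner \<Omega> (f (s k)) (\<lambda>x. u k x - u (k - 1) x))
    \<le> (2 * Linf_norm \<Omega> f + BV_norm \<Omega> f) * M"
proof -
  obtain n where n: "m = Suc n" using m by (cases m) auto
  have s0: "0 \<le> s k" if "1 \<le> k" for k
    using that by (induction k rule: dec_induct) (use s in \<open>auto intro: order_trans less_imp_le\<close>)
  \<comment> \<open>The value at \<open>k = 0\<close>, where there is no evaluation point, is arbitrary; \<open>s 1\<close> keeps it square integrable.\<close>
  define r where "r k = f (s (max 1 k))" for k
  have r: "r k \<in> L2 \<Omega>" "L2_norm \<Omega> (r k) \<le> Linf_norm \<Omega> f" for k
    using f(1) s0[of "max 1 k"] L2_norm_le_Linf[OF f(1)] by (auto simp: r_def Linf_L2_def)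
  have M0: "0 \<le> M" using M[of 0] L2_norm_nonneg[of \<Omega> "u 0"] by simp
  have ends: "\<bar>L2_inner \<Omega> (r k) (u j)\<bar> \<le> Linf_norm \<Omega> f * M" if "j \<le> m" for j k
    using L2_Cauchy_Schwarz[OF r(1) u] M0 r(2)[of k] M[OF that]
    by (meson L2_norm_nonneg mult_mono order_trans)
  have inner: "\<bar>L2_inner \<Omega> (\<lambda>x. r (Suc i) x - r i x) (u i)\<bar> \<le> L2_norm \<Omega> (\<lambda>x. r (Suc i) x - r i x) * M"
    if "i \<le> m" for i
    using L2_Cauchy_Schwarz[OF L2_diff[OF r(1) r(1)] u] M[OF that]
    by (meson L2_norm_nonneg mult_left_mono order_trans)
  have "(\<Sum>k=1..m. L2_inner \<Omega> (f (s k)) (\<lambda>x. u k x - u (k - 1) x))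
     = (\<Sum>k=1..Suc n. L2_inner \<Omega> (r k) (\<lambda>x. u k x - u (k - 1) x))"
    unfolding n by (intro sum.cong) (auto simp: r_def max_def)
  also have "\<dots> = L2_inner \<Omega> (r (Suc n)) (u (Suc n)) - L2_inner \<Omega> (r 1) (u 0)
      - (\<Sum>i=1..n. L2_inner \<Omega> (\<lambda>x. r (Suc i) x - r i x) (u i))"
    by (intro summation_by_parts r u)
  also have "\<dots> \<le> Linf_norm \<Omega> f * M + Linf_norm \<Omega> f * M
      + (\<Sum>i=1..n. L2_norm \<Omega> (\<lambda>x. r (Suc i) x - r i x) * M)"
  proof -
    have "- (\<Sum>i=1..n. L2_inner \<Omega> (\<lambda>x. r (Suc i) x - r i x) (u i))
       \<le> (\<Sum>i=1..n. L2_norm \<Omega> (\<lambda>x. r (Suc i) x - r i x) * M)"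
      unfolding sum_negf[symmetric] using inner n by (intro sum_mono) (fastforce simp: abs_le_iff)
    then show ?thesis
      using ends[of "Suc n" "Suc n"] ends[of 0 1] unfolding n abs_le_iff by linarith
  qed
  also have "\<dots> \<le> Linf_norm \<Omega> f * M + Linf_norm \<Omega> f * M + BV_norm \<Omega> f * M"
  proof -
    have "(\<Sum>i=1..n. L2_norm \<Omega> (\<lambda>x. r (Suc i) x - r i x))
        = (\<Sum>i=1..n. L2_norm \<Omega> (\<lambda>x. f (s (Suc i)) x - f (s (Suc (i - 1))) x))"
      by (intro sum.cong) (auto simp: r_def max_def)
    also have "\<dots> \<le> BV_norm \<Omega> f"
      using s by (intro variation_le_BV[where s = "\<lambda>i. s (Suc i)"] f) auto
    finally show ?thesis using M0 by (simp add: mult_right_mono flip: sum_distrib_right)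
  qed
  finally show ?thesis by (simp add: algebra_simps)
qed

theorem theorem4p1:
  fixes \<Omega> :: "'a::euclidean_space set"
    and \<alpha> \<sigma> \<epsilon> \<Delta>t T_soe C_\<Omega> :: real
    and Nq :: nat and \<theta> \<omega> :: "nat \<Rightarrow> real"
    and f :: "real \<Rightarrow> 'a \<Rightarrow> real"
    and t :: "nat \<Rightarrow> real"
    and u :: "nat \<Rightarrow> 'a \<Rightarrow> real"
  assumes alpha: "0 < \<alpha>" "\<alpha> < 1"
    and sigma: "\<sigma> = 1 - \<alpha> / 2"
    and domain: "bounded_lipschitz_domain \<Omega>"
    and soe_params: "0 < \<epsilon>" "0 < \<Delta>t" "\<Delta>t < T_soe" "1 \<le> Nq"
    and soe_pos: "\<forall>l\<in>{1..Nq}. 0 < \<theta> l \<and> 0 < \<omega> l"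
    and soe_approx: "\<forall>s\<in>{\<Delta>t..T_soe}. \<bar>s powr (- \<alpha>) - soe Nq \<theta> \<omega> s\<bar> \<le> \<epsilon>"
    and source: "f \<in> Linf_L2 \<Omega> \<inter> BV_L2 \<Omega>"
    and initial: "u 0 \<in> H10 \<Omega>"
    and mesh: "t 0 = 0" "\<forall>k\<ge>1. t (k - 1) < t k"
    and mesh_ratio: "\<forall>k\<ge>2. eta \<le> tau t k / tau t (k - 1)"
    and mesh_eps: "\<forall>k\<ge>1. \<epsilon> \<le> 1 / (5 * (1 - \<alpha>) * (\<sigma> * tau t k) powr \<alpha>)"
    and mesh_Delta: "\<forall>k\<ge>2. \<Delta>t \<le> \<sigma> * tau t k"
    and mesh_T: "\<forall>k\<ge>2. \<sigma> * tau t (k + 1) + tau t k \<le> T_soe"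
    and solution: "\<forall>k\<ge>1. u k \<in> H10 \<Omega>"
    and scheme: "\<forall>k\<ge>1. \<forall>v\<in>H10 \<Omega>.
      L2_inner \<Omega> (fast_L21sigma (soe Nq \<theta> \<omega>) \<alpha> \<sigma> t u k) v =
        - L2_inner \<Omega> (\<lambda>x. (1 - \<alpha> / 2) *\<^sub>R weak_grad \<Omega> (u k) x
                            + (\<alpha> / 2) *\<^sub>R weak_grad \<Omega> (u (k - 1)) x) (weak_grad \<Omega> v)
        + L2_inner \<Omega> (f (tstar \<sigma> t k)) v"
    and embedding: "\<forall>v\<in>H10 \<Omega>. L2_norm \<Omega> v \<le> C_\<Omega> * L2_norm \<Omega> (weak_grad \<Omega> v)"
  shows "\<forall>n\<ge>1. L2_norm \<Omega> (weak_grad \<Omega> (u n))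
    \<le> L2_norm \<Omega> (weak_grad \<Omega> (u 0)) + 2 * (2 * Linf_norm \<Omega> f + BV_norm \<Omega> f) * C_\<Omega>"
proof -
  interpret fast_mesh t \<alpha> \<sigma> \<epsilon> \<Delta>t T_soe Nq \<theta> \<omega>
    by unfold_locales
      (use alpha sigma soe_pos soe_approx mesh mesh_ratio mesh_eps mesh_Delta mesh_T in auto)
  interpret bounded_open \<Omega>
    by unfold_locales (use domain in \<open>auto simp: bounded_lipschitz_domain_def\<close>)
  define N where "N k = L2_norm \<Omega> (weak_grad \<Omega> (u k))" for k
  define Cf where "Cf = 2 * Linf_norm \<Omega> f + BV_norm \<Omega> f"
  have f: "f \<in> Linf_L2 \<Omega>" "f \<in> BV_L2 \<Omega>" using source by auto
  have u: "u k \<in> H10 \<Omega>" for k using initial solution by (cases k) auto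
  have uH1: "u k \<in> H1 \<Omega>" and uL2: "u k \<in> L2 \<Omega>" for k
    using H10_H1[OF u] H1_L2 by auto
  have C0: "0 \<le> C_\<Omega>" using embedding by (intro embedding_constant_nonneg) auto
  have "0 \<le> BV_norm \<Omega> f" using variation_le_BV[OF f(2), of "\<lambda>_. 0" 0] by simp
  moreover have "0 \<le> Linf_norm \<Omega> f"
    using L2_norm_le_Linf[OF f(1), of 0] L2_norm_nonneg[of \<Omega> "f 0"] by simp
  ultimately have Cf0: "0 \<le> Cf" by (simp add: Cf_def)
  have "(N m)\<^sup>2 \<le> (N 0)\<^sup>2 + 2 * (Cf * C_\<Omega>) * N m"
    if m: "1 \<le> m" and max: "\<And>k. k \<le> m \<Longrightarrow> N k \<le> N m" for m
  proof -
    let ?\<delta> = "\<lambda>k x. u k x - u (k - 1) x"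
    let ?F = "\<lambda>k. L2_inner \<Omega> (fast_L21sigma K \<alpha> \<sigma> t u k) (?\<delta> k)"
    let ?f = "\<lambda>k. L2_inner \<Omega> (f (tstar \<sigma> t k)) (?\<delta> k)"
    have step: "((N k)\<^sup>2 - (N (k - 1))\<^sup>2) / 2 \<le> ?f k - ?F k" if "1 \<le> k" for k
      using gradient_step[OF alpha uH1 uH1, of k "k - 1"] scheme that H10_diff[OF u u, of k "k - 1"]
      by (simp add: N_def)
    have "((N m)\<^sup>2 - (N 0)\<^sup>2) / 2 = (\<Sum>k=1..m. ((N k)\<^sup>2 - (N (k - 1))\<^sup>2) / 2)"
      by (induction m) (auto simp: field_simps)
    also have "\<dots> \<le> (\<Sum>k=1..m. ?f k - ?F k)" by (intro sum_mono step) auto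
    also have "\<dots> \<le> (\<Sum>k=1..m. ?f k)"
      using fast_form_integral_nonneg[OF uL2, where n = m] by (simp add: sum_subtractf)
    also have "\<dots> \<le> Cf * (C_\<Omega> * N m)"
      unfolding Cf_def
    proof (rule source_term_le[OF f uL2 _ _ _ m])
      show "L2_norm \<Omega> (u k) \<le> C_\<Omega> * N m" if "k \<le> m" for k
        using embedding[rule_format, OF u[of k]] mult_left_mono[OF max[OF that] C0]
        unfolding N_def by linarith
      show "0 \<le> tstar \<sigma> t 1"
        using tstar_between(1)[of 1 \<sigma>] sigma_bounds mesh(1) by simp
      show "tstar \<sigma> t k < tstar \<sigma> t (Suc k)" if "1 \<le> k" for k
        using that sigma_bounds by (intro tstar_less)
    qed
    finally show ?thesis by (simp add: field_simps)
  qed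
  then have "N n \<le> N 0 + 2 * (Cf * C_\<Omega>)" for n
    using C0 Cf0 by (intro max_step_bound) (auto simp: N_def L2_norm_nonneg)
  then show ?thesis unfolding N_def Cf_def mult.assoc by blast
qed

end
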